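(* Let $q\ge4$ be a prime power and let $\overline{\mu}_q=\lim_{x\to+\infty}\frac1x\sum_{n\le x}\mu_q(n)$ be the mean value of $\mu_q(n)$ (this limit exists), where $\mu_q(n)$ is the number of elements of $\mathbb{F}_{q^n}$ normal over $\mathbb{F}_q$ divided by $q^n$. Then $$1-\frac1q-\frac{1}{\sqrt q}<\overline{\mu}_q\le 1-\frac1q.$$
   Context: An element $\beta\in\mathbb{F}_{q^n}$ is normal over $\mathbb{F}_q$ if $\{\beta,\beta^q,\ldots,\beta^{q^{n-1}}\}$ is an $\mathbb{F}_q$-basis of $\mathbb{F}_{q^n}$. *)

theory Defs
  imports
    Complex_Main
    "HOL-Algebra.Embedded_Algebras"
    "HOL-Number_Theory.Prime_Powers"
begin

text \<open>
  Here \<open>F\<close> is a finite field and \<open>K\<close> is the carrier of a subfield with \<open>[F : K] = n\<close>.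
  Bases are lists in \<open>HOL-Algebra.Embedded_Algebras\<close>. An independent list is distinct,
  so passing from the set of conjugates to the list of conjugates changes nothing: if two of
  the conjugates coincide, there are fewer than \<open>n\<close> of them and they cannot form a basis.
\<close>

definition normal_over ::
  "('a, 'm) ring_scheme \<Rightarrow> 'a set \<Rightarrow> nat \<Rightarrow> 'a \<Rightarrow> bool" where
  "normal_over F K n \<beta> \<longleftrightarrow>
     \<beta> \<in> carrier F \<and>
     (let conjs = map (\<lambda>i. \<beta> [^]\<^bsub>F\<^esub> (card K ^ i :: nat)) [0..<n] in
        ring.independent F K conjs \<and> ring.Span F K conjs = carrier F)"

definition normal_density ::
  "('a, 'm) ring_scheme \<Rightarrow> 'a set \<Rightarrow> nat \<Rightarrow> real" where
  "normal_density F K n =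
     real (card {\<beta>. normal_over F K n \<beta>}) / real (card K ^ n)"

end

theory Submission
  imports
    Defs
    "HOL-Algebra.Algebraic_Closure"
    "HOL-Algebra.Multiplicative_Group"
    "HOL-Number_Theory.Residue_Primitive_Roots"
begin

text \<open>
  Write \<open>n = m p\<^sup>k\<close> with \<open>m\<close> prime to the characteristic \<open>p\<close>, and let \<open>\<omega>\<close> be a primitive \<open>m\<close>-th root of
  unity in an algebraic closure of \<open>F\<close>. An element \<open>x\<close> of \<open>F\<close> is normal iff no Lagrange resolvent
  (a sum of \<open>\<omega>\<close>-powers times conjugates, one for each residue \<open>j\<close> modulo \<open>m\<close>) of its trace to the
  field with \<open>q\<^sup>m\<close> elements vanishes. The resolvents at \<open>j\<close> and \<open>j q\<close> determine each other, so the
  vector of resolvents lives in a product over the orbits of multiplication by \<open>q\<close> modulo \<open>m\<close>. The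
  map to this product is injective and both sides have \<open>q\<^sup>m\<close> elements, which gives
  the density \<open>\<Prod> (1 - q\<^sup>-\<^sup>o)\<close> over the orbits, \<open>o\<close> being the orbit length. Sorted by the divisors \<open>d\<close> of \<open>m\<close>,
  this is a product of factors \<open>a(d)\<close> over the divisors \<open>d\<close> of \<open>n\<close>.

  Such a product has a mean value as soon as \<open>\<Sum> (1 - a(d)) / d\<close> converges, because it is uniformly
  approximated in mean by its periodic truncations. The mean is at most \<open>a(1) = 1 - 1/q\<close> and at least
  \<open>a(1) (1 - T)\<close>, where \<open>T\<close> is the sum over \<open>d \<ge> 2\<close>. Grouping the \<open>d\<close> by the order \<open>k\<close> of \<open>q\<close>
  modulo \<open>d\<close>, so that \<open>d\<close> divides \<open>q\<^sup>k - 1\<close>, and using that the sum \<open>S(m)\<close> of \<open>\<phi>(d)/d\<close> over the divisors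
  of \<open>m\<close> satisfies \<open>S(m)\<^sup>2 < m + 1\<close>, one obtains \<open>T \<le> S(q - 1)/q < 1/\<surd>q\<close>.
\<close>

hide_const (open) Divisibility.prime

section \<open>The Frobenius map in prime characteristic\<close>

text \<open>
  This common form of the binomial theorem serves both the Frobenius map, with
  \<open>g j i = (a + b)\<^sup>j a\<^sup>i b\<^sup>p\<^sup>-\<^sup>i\<^sup>-\<^sup>j\<close>, and iterated differences of sequences.
\<close>
lemma (in ring) pascal_finsum:
  fixes g :: "nat \<Rightarrow> nat \<Rightarrow> 'a"
  assumes cl: "\<And>j i. g j i \<in> carrier R"
    and step: "\<And>j i. i + j < N \<Longrightarrow> g (Suc j) i = g j i \<oplus> g j (Suc i)"
  shows "i + j \<le> N \<Longrightarrow> g j i = (\<Oplus>l\<in>{..j}. [(j choose l)] \<cdot> g 0 (i + l))"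
proof (induction j arbitrary: i)
  case 0
  then show ?case using cl by simp
next
  case (Suc j)
  let ?a = "\<lambda>l. g 0 (i + l)"
  have "g (Suc j) i = g j i \<oplus> g j (Suc i)" using step Suc.prems by simp
  also have "g j i = (\<Oplus>l\<in>{..j}. [(j choose l)] \<cdot> ?a l)" using Suc by simp
  also have "\<dots> = (\<Oplus>l\<in>{..Suc j}. [(j choose l)] \<cdot> ?a l)"
    using cl by (subst finsum_Suc) (auto simp: binomial_eq_0)
  also have "\<dots> = (\<Oplus>l\<in>{..j}. [(j choose Suc l)] \<cdot> ?a (Suc l)) \<oplus> ?a 0"
    using cl by (subst finsum_Suc2) auto
  also have "g j (Suc i) = (\<Oplus>l\<in>{..j}. [(j choose l)] \<cdot> ?a (Suc l))"
    using Suc.IH[of "Suc i"] Suc.prems by simp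
  finally have "g (Suc j) i = (\<Oplus>l\<in>{..j}. [(j choose Suc l)] \<cdot> ?a (Suc l) \<oplus> [(j choose l)] \<cdot> ?a (Suc l)) \<oplus> ?a 0"
    using cl by (subst finsum_addf) (auto simp: a_ac)
  also have "\<dots> = (\<Oplus>l\<in>{..j}. [(Suc j choose Suc l)] \<cdot> ?a (Suc l)) \<oplus> ?a 0"
    using cl by (intro arg_cong2[where f="(\<oplus>)"] finsum_cong')
      (auto simp: add.nat_pow_mult add.nat_pow_closed add.commute)
  also have "\<dots> = (\<Oplus>l\<in>{..Suc j}. [(Suc j choose l)] \<cdot> ?a l)"
    using cl by (subst finsum_Suc2) (auto simp del: binomial_Suc_Suc)
  finally show ?case .
qed

locale char_ring = cring R for R (structure) +
  fixes p :: nat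
  assumes prime_p: "prime p" and char_p: "[p] \<cdot> \<one> = \<zero>"
begin

lemma mult_char: "x \<in> carrier R \<Longrightarrow> p dvd j \<Longrightarrow> [j] \<cdot> x = \<zero>"
proof -
  assume x: "x \<in> carrier R" and "p dvd j"
  then obtain i where j: "j = p * i" by auto
  have "[j] \<cdot> x = [i] \<cdot> ([p] \<cdot> (\<one> \<otimes> x))" using x by (simp add: j add.nat_pow_pow)
  also have "[p] \<cdot> (\<one> \<otimes> x) = ([p] \<cdot> \<one>) \<otimes> x" using x by (subst add_pow_ldistr) auto
  finally show ?thesis using x by (simp add: char_p)
qed

text \<open>Of the \<open>p\<close>-th row of binomial coefficients only the two ends survive, since
  \<open>p\<close> divides all the inner ones.\<close>

lemma pascal_prime:
  fixes g :: "nat \<Rightarrow> nat \<Rightarrow> 'a"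
  assumes cl: "\<And>j i. g j i \<in> carrier R"
    and step: "\<And>j i. i + j < p \<Longrightarrow> g (Suc j) i = g j i \<oplus> g j (Suc i)"
  shows "g p 0 = g 0 0 \<oplus> g 0 p"
proof -
  have p0: "0 < p" using prime_p by (rule prime_gt_0_nat)
  have "g p 0 = (\<Oplus>l\<in>{..p}. [(p choose l)] \<cdot> g 0 l)"
    using pascal_finsum[of g p 0 p, OF cl step] by simp
  also have "\<dots> = (\<Oplus>l\<in>{0, p}. [(p choose l)] \<cdot> g 0 l)"
  proof (rule add.finprod_mono_neutral_cong_right)
    fix l assume "l \<in> {..p} - {0, p}"
    then have "p dvd (p choose l)"
      using prime_p by (intro dvd_choose_prime) auto
    then show "[(p choose l)] \<cdot> g 0 l = \<zero>" using cl mult_char by blast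
  qed (use cl in auto)
  also have "\<dots> = g 0 0 \<oplus> g 0 p"
    using p0 cl by simp
  finally show ?thesis .
qed

lemma frob_add_prime:
  assumes "a \<in> carrier R" "b \<in> carrier R"
  shows "(a \<oplus> b) [^] p = a [^] p \<oplus> b [^] p"
proof -
  define g where "g j i = (a \<oplus> b) [^] (j::nat) \<otimes> (a [^] (i::nat) \<otimes> b [^] (p - i - j))" for j i
  have "g p 0 = g 0 0 \<oplus> g 0 p"
  proof (rule pascal_prime)
    fix j i :: nat assume "i + j < p"
    then have e: "p - i - j = Suc (p - i - Suc j)" by simp
    define d where "d = p - i - Suc j"
    have d: "p - i - j = Suc d" "p - Suc i - j = d" "p - i - Suc j = d" 
      using \<open>i + j < p\<close> unfolding d_def by auto
    show "g (Suc j) i = g j i \<oplus> g j (Suc i)"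
      unfolding g_def d using assms by (simp add: l_distr r_distr m_ac a_ac)
  qed (use assms in \<open>simp add: g_def\<close>)
  then show ?thesis using assms by (simp add: g_def a_comm)
qed

lemma frob_add: 
  assumes "a \<in> carrier R" "b \<in> carrier R"
  shows "(a \<oplus> b) [^] (p ^ e) = a [^] (p ^ e) \<oplus> b [^] (p ^ e)"
proof (induction e)
  case (Suc e)
  have "(a \<oplus> b) [^] (p ^ Suc e) = ((a \<oplus> b) [^] (p ^ e)) [^] p"
    using assms by (simp add: nat_pow_pow mult.commute)
  also have "\<dots> = (a [^] (p ^ e)) [^] p \<oplus> (b [^] (p ^ e)) [^] p"
    using Suc assms by (simp add: frob_add_prime)
  finally show ?case using assms by (simp add: nat_pow_pow mult.commute)
qed (use assms in auto)

lemma frob_zero: "\<zero> [^] (p ^ e) = \<zero>"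
  using prime_p by (simp add: nat_pow_zero prime_gt_0_nat)

lemma frob_minus: 
  assumes "a \<in> carrier R"
  shows "(\<ominus> a) [^] (p ^ e) = \<ominus> (a [^] (p ^ e))"
proof -
  have "(a \<oplus> \<ominus> a) [^] (p ^ e) = a [^] (p ^ e) \<oplus> (\<ominus> a) [^] (p ^ e)"
    using assms by (intro frob_add) auto
  then have "(\<ominus> a) [^] (p ^ e) \<oplus> a [^] (p ^ e) = \<zero>"
    using assms by (simp add: r_neg frob_zero a_comm)
  then show ?thesis using assms by (simp add: minus_equality)
qed

lemma frob_diff: 
  assumes "a \<in> carrier R" "b \<in> carrier R"
  shows "(a \<ominus> b) [^] (p ^ e) = a [^] (p ^ e) \<ominus> b [^] (p ^ e)"
  using assms by (simp add: a_minus_def frob_add frob_minus)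

lemma frob_finsum: 
  assumes "\<And>i. i \<in> A \<Longrightarrow> f i \<in> carrier R"
  shows "(\<Oplus>i\<in>A. f i) [^] (p ^ e) = (\<Oplus>i\<in>A. f i [^] (p ^ e))"
  using assms 
proof (induction A rule: infinite_finite_induct)
  case (insert x A)
  then have "f \<in> A \<rightarrow> carrier R" by auto
  with insert show ?case by (simp add: frob_add Pi_def)
qed (auto simp: frob_zero)

end

section \<open>Roots in algebraically closed fields\<close>

text \<open>Polynomials of HOL-Algebra are lists with the leading coefficient first, hence the
  \<open>rev\<close>. Through this bridge every later polynomial can be given by its coefficient
  function.\<close>

lemma (in ring) eval_coeff_list:
  fixes c :: "nat \<Rightarrow> 'a"
  assumes "\<And>i. c i \<in> carrier R" "x \<in> carrier R"
  shows "eval (rev (map c [0..<d])) x = (\<Oplus>i\<in>{..<d}. c i \<otimes> x [^] i)"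
proof (induction d)
  case (Suc d)
  have "rev (map c [0..<Suc d]) = c d # rev (map c [0..<d])" by simp
  with Suc assms show ?case by (simp add: lessThan_Suc)
qed simp

lemma (in ring) coeff_list_in_poly_ring:
  fixes c :: "nat \<Rightarrow> 'a"
  assumes "\<And>i. c i \<in> carrier R" "c d \<noteq> \<zero>"
  shows "rev (map c [0..<Suc d]) \<in> carrier (poly_ring R)"
  using assms unfolding sym[OF univ_poly_carrier] polynomial_def by auto

lemma card_set_mset_le_size: "card (set_mset M) \<le> size M"
  by (induction M) (auto simp: card_insert_if)

lemma (in field) finsum_roots_bound:
  fixes c :: "nat \<Rightarrow> 'a"
  assumes "\<And>i. c i \<in> carrier R" "c d \<noteq> \<zero>"
  shows "finite {x \<in> carrier R. (\<Oplus>i\<in>{..d}. c i \<otimes> x [^] i) = \<zero>}"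
    and "card {x \<in> carrier R. (\<Oplus>i\<in>{..d}. c i \<otimes> x [^] i) = \<zero>} \<le> d"
proof -
  let ?P = "rev (map c [0..<Suc d])"
  note P = coeff_list_in_poly_ring[of c, OF assms]
  have sub: "{x \<in> carrier R. (\<Oplus>i\<in>{..d}. c i \<otimes> x [^] i) = \<zero>} \<subseteq> set_mset (roots ?P)"
    using eval_coeff_list[of c _ "Suc d", OF assms(1)] roots_mem_iff_is_root[OF P]
    by (auto simp: is_root_def lessThan_Suc_atMost)
  then show "finite {x \<in> carrier R. (\<Oplus>i\<in>{..d}. c i \<otimes> x [^] i) = \<zero>}"
    by (rule finite_subset) simp
  have "card {x \<in> carrier R. (\<Oplus>i\<in>{..d}. c i \<otimes> x [^] i) = \<zero>} \<le> card (set_mset (roots ?P))"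
    by (rule card_mono[OF _ sub]) simp
  also have "\<dots> \<le> size (roots ?P)" by (rule card_set_mset_le_size)
  also have "\<dots> \<le> degree ?P" by (rule size_roots_le_degree[OF P])
  finally show "card {x \<in> carrier R. (\<Oplus>i\<in>{..d}. c i \<otimes> x [^] i) = \<zero>} \<le> d" by simp
qed

lemma (in algebraically_closed) finsum_root_exists:
  fixes c :: "nat \<Rightarrow> 'a"
  assumes "\<And>i. c i \<in> carrier L" "c d \<noteq> \<zero>" "d > 0"
  shows "\<exists>x\<in>carrier L. (\<Oplus>i\<in>{..d}. c i \<otimes> x [^] i) = \<zero>"
proof -
  let ?P = "rev (map c [0..<Suc d])"
  note P = coeff_list_in_poly_ring[of c, OF assms(1-2)]
  have "size (roots ?P) = degree ?P"
    using roots_over_carrier[OF P] by (simp add: splitted_def)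
  then have "roots ?P \<noteq> {#}" using \<open>d > 0\<close> by force
  then obtain x where "x \<in># roots ?P" by auto
  then have "is_root ?P x" using roots_mem_iff_is_root[OF P] by blast
  then show ?thesis
    using eval_coeff_list[of c _ "Suc d", OF assms(1)]
    by (auto simp: is_root_def lessThan_Suc_atMost)
qed

lemma (in algebraically_closed) nth_root_exists:
  assumes "a \<in> carrier L" "l > 0"
  shows "\<exists>x\<in>carrier L. x [^] (l::nat) = a"
proof -
  \<comment> \<open>The coefficients of X^l - a.\<close>
  define c where "c i = (if i = l then \<one> else if i = 0 then \<ominus> a else \<zero>)" for i :: nat
  have "\<exists>x\<in>carrier L. (\<Oplus>i\<in>{..l}. c i \<otimes> x [^] i) = \<zero>"
    using assms by (intro finsum_root_exists) (auto simp: c_def)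
  then obtain x where x: "x \<in> carrier L" "(\<Oplus>i\<in>{..l}. c i \<otimes> x [^] i) = \<zero>" by auto
  have "(\<Oplus>i\<in>{..l}. c i \<otimes> x [^] i) = (\<Oplus>i\<in>{0, l}. c i \<otimes> x [^] i)"
    using assms x by (intro add.finprod_mono_neutral_cong_right) (auto simp: c_def)
  also have "\<dots> = \<ominus> a \<oplus> x [^] l" using assms x by (simp add: c_def)
  finally have "x [^] l \<oplus> \<ominus> a = \<zero>" using x assms by (simp add: a_comm)
  then have "x [^] l = \<ominus> (\<ominus> a)" using x assms by (intro sym[OF minus_equality]) auto
  then show ?thesis using x assms by auto
qed

section \<open>Primitive roots of unity\<close>

lemma (in cring) geometric_finsum:
  assumes "x \<in> carrier R"
  shows "(x \<ominus> \<one>) \<otimes> (\<Oplus>i\<in>{..<n}. x [^] (i::nat)) = x [^] n \<ominus> \<one>"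
proof (induction n)
  case (Suc n)
  have "(x \<ominus> \<one>) \<otimes> (\<Oplus>i\<in>{..<Suc n}. x [^] i) = (x \<ominus> \<one>) \<otimes> x [^] n \<oplus> (x [^] n \<ominus> \<one>)"
    using assms Suc by (simp add: lessThan_Suc r_distr)
  also have "\<dots> = ((x \<ominus> \<one>) \<oplus> \<one>) \<otimes> x [^] n \<ominus> \<one>"
    using assms by (simp add: a_minus_def l_distr a_ac)
  also have "\<dots> = x [^] Suc n \<ominus> \<one>"
    using assms by (simp add: a_minus_def a_assoc l_neg m_comm)
  finally show ?case .
qed (use assms in \<open>simp add: a_minus_def r_neg\<close>)

text \<open>This says that \<open>w\<close> has multiplicative order exactly \<open>m\<close>, in
  the divisibility form used in all exponent computations.\<close>

definition (in monoid) primitive_root :: "nat \<Rightarrow> 'a \<Rightarrow> bool" where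
  "primitive_root m w \<longleftrightarrow> w \<in> carrier G \<and> (\<forall>i::nat. w [^] i = \<one> \<longleftrightarrow> m dvd i)"

locale alg_closed_char = algebraically_closed L + char_ring L p for L (structure) and p
begin

text \<open>Bezout gives \<open>m * x = p * y + 1\<close>; if the multiples \<open>m\<close> and
  \<open>p\<close> of \<open>\<one>\<close> both vanished, then \<open>\<one>\<close> would be
  zero.\<close>

lemma coprime_char_nonzero:
  assumes "coprime m p" shows "[m] \<cdot> \<one> \<noteq> \<zero>"
proof
  assume m: "[m] \<cdot> \<one> = \<zero>"
  show False
  proof (cases "p = 1")
    case False
    obtain x y where xy: "m * x = p * y + 1"
      using coprime_bezout_strong[OF assms False] by auto
    have "[(m * x)] \<cdot> \<one> = [x] \<cdot> ([m] \<cdot> \<one>)" by (simp add: add.nat_pow_pow)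
    moreover have "[(p * y)] \<cdot> \<one> = [y] \<cdot> ([p] \<cdot> \<one>)" by (simp add: add.nat_pow_pow)
    ultimately show False using m char_p xy by (simp add: add.nat_pow_mult[symmetric])
  qed (use prime_p in auto)
qed

text \<open>A root of 1 + X + ... + X^(l-1) is an \<open>l\<close>-th root of unity. It differs from
  \<open>\<one>\<close> because the value of the polynomial there is \<open>l\<close>, nonzero in
  characteristic \<open>p\<close>; as \<open>l\<close> is prime, its order is then
  \<open>l\<close>.\<close>

lemma primitive_root_prime:
  assumes l: "prime l" "l \<noteq> p"
  shows "\<exists>w. primitive_root l w"
proof -
  have l0: "l > 1" using l(1) by (rule prime_gt_1_nat)
  have "\<exists>x\<in>carrier L. (\<Oplus>i\<in>{..l - 1}. (\<lambda>_. \<one>) i \<otimes> x [^] i) = \<zero>"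
    using l0 by (intro finsum_root_exists) auto
  moreover have "{..l - 1} = {..<l}" using l0 by auto
  ultimately obtain x where x: "x \<in> carrier L" "(\<Oplus>i\<in>{..<l}. \<one> \<otimes> x [^] i) = \<zero>" by auto
  have s: "(\<Oplus>i\<in>{..<l}. x [^] i) = \<zero>"
    using x by (metis (no_types, lifting) add.finprod_cong' l_one nat_pow_closed Pi_I)
  have "x [^] l \<ominus> \<one> = \<zero>" using geometric_finsum[OF x(1), of l] s x by simp
  then have xl: "x [^] l = \<one>" using x by simp
  have x1: "x \<noteq> \<one>"
  proof
    assume "x = \<one>"
    then have "(\<Oplus>i\<in>{..<l}. \<one>) = \<zero>" using s by simp
    then have "[l] \<cdot> \<one> = \<zero>" by (subst (asm) add.finprod_const) auto
    then show False using coprime_char_nonzero[of l] l prime_p primes_coprime by blast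
  qed
  have "x [^] i = \<one> \<longleftrightarrow> l dvd i" for i :: nat
  proof
    assume "l dvd i"
    then show "x [^] i = \<one>" using x xl by (metis dvdE nat_pow_one nat_pow_pow)
  next
    assume i: "x [^] i = \<one>"
    show "l dvd i"
    proof (rule ccontr)
      assume "\<not> l dvd i"
      then have "coprime i l" using l(1) prime_imp_coprime coprime_commute by blast
      then obtain a b where ab: "i * a = l * b + 1"
        using coprime_bezout_strong l0 by blast
      have "x [^] (i * a) = \<one>" "x [^] (l * b) = \<one>"
        using x i xl by (metis nat_pow_one nat_pow_pow)+
      then show False using ab x x1 by simp
    qed
  qed
  then show ?thesis using x unfolding primitive_root_def by auto
qed

text \<open>Induction that strips one prime \<open>l\<close> from \<open>m = l * m'\<close>. If
  \<open>l\<close> divides \<open>m'\<close>, an \<open>l\<close>-th root of a primitive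
  \<open>m'\<close>-th root has order \<open>m\<close>; otherwise the orders \<open>l\<close> and
  \<open>m'\<close> are coprime and the product of two primitive roots works.\<close>

lemma primitive_root_exists:
  "coprime m p \<Longrightarrow> m > 0 \<Longrightarrow> \<exists>w. primitive_root m w"
proof (induction m rule: less_induct)
  case (less m)
  show ?case
  proof (cases "m = 1")
    case True
    then show ?thesis by (intro exI[of _ \<one>]) (simp add: primitive_root_def)
  next
    case False
    then obtain l where l: "prime l" "l dvd m" using prime_factor_nat by blast
    then obtain m' where m: "m = l * m'" by auto
    have l0: "l > 1" using l(1) by (rule prime_gt_1_nat)
    then have "m' < m" "m' > 0" using m \<open>m > 0\<close> by auto
    moreover have "coprime m' p" "coprime l p" using less.prems m by auto
    ultimately obtain w where w: "primitive_root m' w" using less.IH by blast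
    then have wc: "w \<in> carrier L" and wi: "\<And>i::nat. w [^] i = \<one> \<longleftrightarrow> m' dvd i"
      unfolding primitive_root_def by auto
    show ?thesis
    proof (cases "l dvd m'")
      case True
      obtain x where x: "x \<in> carrier L" "x [^] l = w"
        using nth_root_exists[OF wc, of l] l0 by auto
      have "x [^] i = \<one> \<longleftrightarrow> m dvd i" for i :: nat
      proof
        assume "m dvd i"
        then obtain j where "i = l * (m' * j)" unfolding m by (metis dvdE mult.assoc)
        then have "x [^] i = w [^] (m' * j)" using x nat_pow_pow by metis
        then show "x [^] i = \<one>" using wi by simp
      next
        assume i: "x [^] i = \<one>"
        \<comment> \<open>First \<open>l\<close> is shown to divide \<open>i\<close>, because
          \<open>l dvd m'\<close> and \<open>m' dvd i\<close>; only then is \<open>x [^] i\<close> a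
          power of \<open>w\<close>.\<close>
        have "w [^] i = (x [^] i) [^] l" using x by (metis nat_pow_pow mult.commute)
        then have "m' dvd i" using i wi by simp
        then obtain j where j: "i = l * j" using True by (metis dvd_trans dvdE)
        then have "w [^] j = \<one>" using i x nat_pow_pow by metis
        then show "m dvd i" using wi j m by simp
      qed
      then show ?thesis using x unfolding primitive_root_def by auto
    next
      case False
      have "l \<noteq> p" using \<open>coprime l p\<close> l0 by auto
      then obtain z where z: "primitive_root l z" using primitive_root_prime l by auto
      then have zc: "z \<in> carrier L" and zi: "\<And>i::nat. z [^] i = \<one> \<longleftrightarrow> l dvd i"
        unfolding primitive_root_def by auto
      have cop: "coprime l m'" using False l(1) prime_imp_coprime by blast
      have "(w \<otimes> z) [^] i = \<one> \<longleftrightarrow> m dvd i" for i :: nat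
      proof
        assume "m dvd i"
        then have "m' dvd i" "l dvd i" unfolding m by (auto elim: dvd_mult_left dvd_mult_right)
        then have "w [^] i = \<one>" "z [^] i = \<one>" using wi zi by auto
        then show "(w \<otimes> z) [^] i = \<one>" using wc zc by (simp add: nat_pow_distrib)
      next
        assume i: "(w \<otimes> z) [^] i = \<one>"
        \<comment> \<open>Raising to the power \<open>l\<close> removes \<open>z\<close>, so that
          \<open>m'\<close> divides \<open>i * l\<close> and hence, by coprimality,
          \<open>i\<close>.\<close>
        have "(w \<otimes> z) [^] (i * l) = \<one>" using i wc zc by (metis m_closed nat_pow_one nat_pow_pow)
        then have "w [^] (i * l) \<otimes> z [^] (i * l) = \<one>" using wc zc by (simp add: nat_pow_distrib)
        then have "w [^] (i * l) = \<one>" using wc zc zi[of "i * l"] by simp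
        then have d1: "m' dvd i" using wi cop by (simp add: coprime_commute coprime_dvd_mult_left_iff)
        then have "w [^] i = \<one>" using wi by simp
        then have "z [^] i = \<one>" using i wc zc by (simp add: nat_pow_distrib)
        then have "l dvd i" using zi by simp
        then show "m dvd i" using d1 cop m semiring_gcd_class.divides_mult by blast
      qed
      then show ?thesis using wc zc unfolding primitive_root_def by (intro exI[of _ "w \<otimes> z"]) auto
    qed
  qed
qed

end

section \<open>Fixed fields of the Frobenius map\<close>

lemma (in abelian_monoid) finsum_add_lessThan:
  fixes f :: "nat \<Rightarrow> 'a"
  assumes "\<And>i. f i \<in> carrier G"
  shows "(\<Oplus>i\<in>{..<a + b}. f i) = (\<Oplus>i\<in>{..<a}. f i) \<oplus> (\<Oplus>i\<in>{..<b}. f (a + i))"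
  using assms by (induction b) (simp_all add: lessThan_Suc a_ac)

lemma (in abelian_monoid) finsum_mult_lessThan:
  fixes f :: "nat \<Rightarrow> 'a"
  assumes "\<And>i. f i \<in> carrier G"
  shows "(\<Oplus>i\<in>{..<a * b}. f i) = (\<Oplus>t\<in>{..<b}. \<Oplus>i\<in>{..<a}. f (a * t + i))"
proof (induction b)
  case (Suc b)
  have "(\<Oplus>i\<in>{..<a * Suc b}. f i) = (\<Oplus>i\<in>{..<a * b + a}. f i)" by (simp add: add.commute)
  also have "\<dots> = (\<Oplus>i\<in>{..<a * b}. f i) \<oplus> (\<Oplus>i\<in>{..<a}. f (a * b + i))"
    using assms by (rule finsum_add_lessThan)
  finally show ?case using Suc assms by (simp add: lessThan_Suc a_ac)
qed simp

lemma (in abelian_monoid) finsum_swap: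
  assumes "finite A" "finite B" "\<And>a b. a \<in> A \<Longrightarrow> b \<in> B \<Longrightarrow> f a b \<in> carrier G"
  shows "(\<Oplus>a\<in>A. \<Oplus>b\<in>B. f a b) = (\<Oplus>b\<in>B. \<Oplus>a\<in>A. f a b)"
  using assms(1,3)
proof (induction A)
  case (insert x A)
  have "(\<Oplus>a\<in>insert x A. \<Oplus>b\<in>B. f a b) = (\<Oplus>b\<in>B. f x b) \<oplus> (\<Oplus>a\<in>A. \<Oplus>b\<in>B. f a b)"
    using insert by (subst finsum_insert) (auto intro!: finsum_closed)
  also have "\<dots> = (\<Oplus>b\<in>B. f x b) \<oplus> (\<Oplus>b\<in>B. \<Oplus>a\<in>A. f a b)"
    using insert by simp
  also have "\<dots> = (\<Oplus>b\<in>B. f x b \<oplus> (\<Oplus>a\<in>A. f a b))"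
    using insert by (subst finsum_addf) (auto intro!: finsum_closed)
  also have "\<dots> = (\<Oplus>b\<in>B. \<Oplus>a\<in>insert x A. f a b)"
    using insert by (intro finsum_cong') (auto intro!: finsum_closed)
  finally show ?case .
qed simp

text \<open>The windows of length \<open>N\<close> starting at \<open>t\<close> and at
  \<open>t + 1\<close> lie in a common window of length \<open>N + 1\<close>, whose first and last
  terms agree.\<close>

lemma (in abelian_group) finsum_periodic_shift:
  fixes f :: "nat \<Rightarrow> 'a"
  assumes cl: "\<And>i. f i \<in> carrier G" and per: "\<And>i. f (i + N) = f i"
  shows "(\<Oplus>i\<in>{..<N}. f (i + t)) = (\<Oplus>i\<in>{..<N}. f i)"
proof (induction t)
  case (Suc t)
  have "f t \<oplus> (\<Oplus>i\<in>{..<N}. f (i + Suc t)) = (\<Oplus>i\<in>{..<1}. f (i + t)) \<oplus> (\<Oplus>i\<in>{..<N}. f (1 + i + t))"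
    using cl by (simp add: lessThan_Suc)
  also have "\<dots> = (\<Oplus>i\<in>{..<1 + N}. f (i + t))"
    using cl by (subst finsum_add_lessThan) auto
  also have "\<dots> = (\<Oplus>i\<in>{..<N + 1}. f (i + t))" by (simp only: add.commute)
  also have "\<dots> = (\<Oplus>i\<in>{..<N}. f (i + t)) \<oplus> (\<Oplus>i\<in>{..<1}. f (N + i + t))"
    using cl by (subst finsum_add_lessThan) auto
  also have "\<dots> = f t \<oplus> (\<Oplus>i\<in>{..<N}. f (i + t))"
    using cl per[of t] by (simp add: lessThan_Suc add.commute a_comm)
  finally have "f t \<oplus> (\<Oplus>i\<in>{..<N}. f (i + Suc t)) = f t \<oplus> (\<Oplus>i\<in>{..<N}. f (i + t))" .
  then show ?case using cl Suc by (simp add: add.l_cancel)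
qed simp

text \<open>These are the roots of a X^Q - X. The case \<open>a = \<one>\<close> bounds the fixed
  fields of Frobenius, and a root of unity \<open>a\<close> bounds the range of a resolvent.\<close>

lemma (in field) power_fixpoints_bound:
  assumes "a \<in> carrier R" "a \<noteq> \<zero>" "(Q::nat) > 1"
  shows "finite {u \<in> carrier R. a \<otimes> u [^] Q = u}" "card {u \<in> carrier R. a \<otimes> u [^] Q = u} \<le> Q"
proof -
  define c where "c i = (if i = Q then a else if i = 1 then \<ominus> \<one> else \<zero>)" for i :: nat
  have c: "c i \<in> carrier R" for i using assms by (auto simp: c_def)
  have cQ: "c Q \<noteq> \<zero>" using assms by (simp add: c_def)
  have "(\<Oplus>i\<in>{..Q}. c i \<otimes> x [^] i) = a \<otimes> x [^] Q \<ominus> x" if x: "x \<in> carrier R" for x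
  proof -
    have "(\<Oplus>i\<in>{..Q}. c i \<otimes> x [^] i) = (\<Oplus>i\<in>{1, Q}. c i \<otimes> x [^] i)"
      using assms x by (intro add.finprod_mono_neutral_cong_right) (auto simp: c_def)
    also have "\<dots> = a \<otimes> x [^] Q \<ominus> x"
      using assms x by (simp add: c_def a_minus_def l_minus a_comm)
    finally show ?thesis .
  qed
  then have "{x \<in> carrier R. (\<Oplus>i\<in>{..Q}. c i \<otimes> x [^] i) = \<zero>} = {u \<in> carrier R. a \<otimes> u [^] Q = u}"
    using assms by auto
  then show "finite {u \<in> carrier R. a \<otimes> u [^] Q = u}" "card {u \<in> carrier R. a \<otimes> u [^] Q = u} \<le> Q"
    using finsum_roots_bound[of c, OF c cQ] by auto
qed

lemma (in domain) nat_pow_eq_zero: "x \<in> carrier R \<Longrightarrow> x [^] (i::nat) = \<zero> \<Longrightarrow> x = \<zero>"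
  by (induction i) (auto dest: integral)

text \<open>At most \<open>b\<close> fibres of size at most \<open>N\<close> cover a set of
  \<open>b * N\<close> elements, so every inequality is an equality. Upper bounds alone thus give
  surjectivity and exact fibre sizes.\<close>

lemma fibre_count:
  fixes b N :: nat
  assumes "finite B" "f ` A \<subseteq> B" "finite A" "card A = b * N" "card B \<le> b" "N > 0"
    and le: "\<And>y. y \<in> B \<Longrightarrow> card {x \<in> A. f x = y} \<le> N"
  shows "card B = b" and "\<And>y. y \<in> B \<Longrightarrow> card {x \<in> A. f x = y} = N"
proof -
  have "A = (\<Union>y\<in>B. {x \<in> A. f x = y})" using assms by auto
  then have "card A = card (\<Union>y\<in>B. {x \<in> A. f x = y})" by simp
  also have "\<dots> = (\<Sum>y\<in>B. card {x \<in> A. f x = y})"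
    using assms by (intro card_UN_disjoint) auto
  finally have eq: "b * N = (\<Sum>y\<in>B. card {x \<in> A. f x = y})" using assms by simp
  also have "\<dots> \<le> card B * N" using sum_bounded_above[of B "\<lambda>y. card {x \<in> A. f x = y}" N] le by simp
  finally show cb: "card B = b" using assms by simp
  fix y assume y: "y \<in> B"
  show "card {x \<in> A. f x = y} = N"
  proof (rule ccontr)
    assume "card {x \<in> A. f x = y} \<noteq> N"
    then have "card {x \<in> A. f x = y} < N" using le[OF y] by simp
    then have "(\<Sum>y\<in>B. card {x \<in> A. f x = y}) < (\<Sum>y\<in>B. N)"
      using le y assms by (intro sum_strict_mono_ex1) auto
    then show False using eq cb by simp
  qed
qed

section \<open>Iterates of the \<open>q\<close>-power map and their fixed points\<close>

locale frobenius_field = alg_closed_char L p for L (structure) and p +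
  fixes q r :: nat
  assumes q_eq: "q = p ^ r" and r_pos: "r > 0"
begin

lemma q_gt_1: "q > 1"
  unfolding q_eq using prime_gt_1_nat[OF prime_p] r_pos by (rule one_less_power)

definition fr :: "nat \<Rightarrow> 'a \<Rightarrow> 'a" where "fr i x = x [^] (q ^ i)"

lemma fr_eq: "fr i x = x [^] (p ^ (r * i))"
proof -
  have "q ^ i = p ^ (r * i)" by (simp add: q_eq power_mult)
  then show ?thesis by (simp only: fr_def)
qed

lemma fr_closed [simp]: "x \<in> carrier L \<Longrightarrow> fr i x \<in> carrier L"
  by (simp add: fr_def)

lemma fr_0 [simp]: "x \<in> carrier L \<Longrightarrow> fr 0 x = x"
  by (simp add: fr_def)

lemma fr_fr: "x \<in> carrier L \<Longrightarrow> fr i (fr j x) = fr (i + j) x"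
  by (simp add: fr_def nat_pow_pow power_add mult.commute)

lemma fr_add: "x \<in> carrier L \<Longrightarrow> y \<in> carrier L \<Longrightarrow> fr i (x \<oplus> y) = fr i x \<oplus> fr i y"
  by (simp add: fr_eq frob_add)

lemma fr_diff: "x \<in> carrier L \<Longrightarrow> y \<in> carrier L \<Longrightarrow> fr i (x \<ominus> y) = fr i x \<ominus> fr i y"
  by (simp add: fr_eq frob_diff)

lemma fr_mult: "x \<in> carrier L \<Longrightarrow> y \<in> carrier L \<Longrightarrow> fr i (x \<otimes> y) = fr i x \<otimes> fr i y"
  by (simp add: fr_def nat_pow_distrib)

lemma fr_finsum: "(\<And>a. a \<in> A \<Longrightarrow> f a \<in> carrier L) \<Longrightarrow> fr i (\<Oplus>a\<in>A. f a) = (\<Oplus>a\<in>A. fr i (f a))"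
  by (simp add: fr_eq frob_finsum)

lemma fr_zero [simp]: "fr i \<zero> = \<zero>"
  by (simp add: fr_eq frob_zero)

lemma fr_eq_zero_iff: "x \<in> carrier L \<Longrightarrow> fr i x = \<zero> \<longleftrightarrow> x = \<zero>"
  using nat_pow_eq_zero[of x "q ^ i"] fr_zero[of i] unfolding fr_def by auto

text \<open>For \<open>i > 0\<close> this is the subfield of \<open>L\<close> with
  \<open>q ^ i\<close> elements. Counting roots yields only the upper bound; equality comes later
  from the embedded finite fields.\<close>

definition Fx :: "nat \<Rightarrow> 'a set" where "Fx i = {x \<in> carrier L. fr i x = x}"

lemma Fx_carrier: "x \<in> Fx i \<Longrightarrow> x \<in> carrier L"
  by (simp add: Fx_def)

lemma fr_period: "x \<in> Fx N \<Longrightarrow> fr (i + N) x = fr i x"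
  using fr_fr[of x i N] by (simp add: Fx_def)

lemma fr_period_mult: "x \<in> Fx N \<Longrightarrow> fr (i + N * j) x = fr i x"
proof (induction j)
  case (Suc j)
  then show ?case using fr_period[of x N "i + N * j"] by (simp add: add_ac)
qed simp

lemma fr_const: "c \<in> Fx 1 \<Longrightarrow> fr i c = c"
  using fr_period_mult[of c 1 0 i] by (simp add: Fx_carrier)

lemma Fx_1_subset: "Fx 1 \<subseteq> Fx i"
  using fr_const by (auto simp: Fx_def)

lemma Fx_finite: "i > 0 \<Longrightarrow> finite (Fx i)" and Fx_card: "i > 0 \<Longrightarrow> card (Fx i) \<le> q ^ i"
proof -
  assume "i > 0"
  with q_gt_1 have "q ^ i > 1" by (rule one_less_power)
  moreover have "Fx i = {u \<in> carrier L. \<one> \<otimes> u [^] (q ^ i) = u}"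
    by (auto simp: Fx_def fr_def)
  ultimately show "finite (Fx i)" "card (Fx i) \<le> q ^ i"
    using power_fixpoints_bound[of \<one> "q ^ i"] by auto
qed

lemma Fx_diff: "x \<in> Fx i \<Longrightarrow> y \<in> Fx i \<Longrightarrow> x \<ominus> y \<in> Fx i"
  by (simp add: Fx_def fr_diff)

lemma Fx_mult: "x \<in> Fx i \<Longrightarrow> y \<in> Fx i \<Longrightarrow> x \<otimes> y \<in> Fx i"
  by (simp add: Fx_def fr_mult)

lemma Fx_fr: "x \<in> Fx i \<Longrightarrow> fr j x \<in> Fx i"
  using fr_fr[of x i j] fr_fr[of x j i] by (simp add: Fx_def add.commute)

lemma Fx_finsum: "(\<And>a. a \<in> A \<Longrightarrow> f a \<in> Fx i) \<Longrightarrow> (\<Oplus>a\<in>A. f a) \<in> Fx i"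
proof -
  assume *: "\<And>a. a \<in> A \<Longrightarrow> f a \<in> Fx i"
  then have "fr i (\<Oplus>a\<in>A. f a) = (\<Oplus>a\<in>A. fr i (f a))" by (intro fr_finsum) (auto simp: Fx_def)
  also have "\<dots> = (\<Oplus>a\<in>A. f a)" using * by (intro finsum_cong') (auto simp: Fx_def)
  finally show ?thesis using * by (auto simp: Fx_def intro!: finsum_closed)
qed

section \<open>Iterated differences of sequences in characteristic \<open>p\<close>\<close>

definition shift_diff :: "nat \<Rightarrow> (nat \<Rightarrow> 'a) \<Rightarrow> nat \<Rightarrow> 'a" where
  "shift_diff s c = (\<lambda>i. c (i + s) \<ominus> c i)"

lemma shift_diff_funpow_closed: 
  "(\<And>i. c i \<in> carrier L) \<Longrightarrow> (shift_diff s ^^ j) c i \<in> carrier L"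
  by (induction j arbitrary: i) (auto simp: shift_diff_def)

text \<open>With E the shift operator, this is (E^s - 1)^p = E^(sp) - 1 in characteristic
  \<open>p\<close>.\<close>

lemma shift_diff_prime:
  assumes c: "\<And>i. c i \<in> carrier L"
  shows "(shift_diff s ^^ p) c = shift_diff (s * p) c"
proof
  fix x
  \<comment> \<open>The sign turns the recurrence for differences into Pascal's rule.\<close>
  define g where "g j i = (\<ominus> \<one>) [^] (i + j) \<otimes> (shift_diff s ^^ j) c (x + i * s)" for i j :: nat
  note cl = shift_diff_funpow_closed[of c, OF c]
  have "g p 0 = g 0 0 \<oplus> g 0 p"
  proof (rule pascal_prime)
    fix j i :: nat
    let ?a = "(\<ominus> \<one>) [^] (i + j)" and ?u = "(shift_diff s ^^ j) c (x + i * s)" 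
      and ?v = "(shift_diff s ^^ j) c (x + Suc i * s)"
    have a: "?a \<in> carrier L" by simp
    have "g (Suc j) i = \<ominus> ?a \<otimes> (?v \<ominus> ?u)"
      unfolding g_def by (simp add: shift_diff_def r_minus add_ac)
    also have "\<dots> = ?a \<otimes> ?u \<oplus> (\<ominus> ?a) \<otimes> ?v"
      using cl a by (simp add: a_minus_def l_minus r_minus r_distr minus_add a_comm)
    also have "\<dots> = g j i \<oplus> g j (Suc i)"
      unfolding g_def by (simp add: r_minus)
    finally show "g (Suc j) i = g j i \<oplus> g j (Suc i)" .
  qed (use cl in \<open>auto simp: g_def\<close>)
  \<comment> \<open>Deduced from additivity of the \<open>p\<close>-th power rather than from
    parity, so that \<open>p = 2\<close> is covered.\<close>
  moreover have "(\<ominus> \<one>) [^] p = \<ominus> \<one>" using frob_minus[of \<one> 1] by simp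
  ultimately have "\<ominus> ((shift_diff s ^^ p) c x) = c x \<ominus> c (x + p * s)"
    using c cl by (simp add: g_def l_minus a_minus_def)
  then have "(shift_diff s ^^ p) c x = \<ominus> (c x \<ominus> c (x + p * s))"
    using cl by (metis minus_minus)
  then show "(shift_diff s ^^ p) c x = shift_diff (s * p) c x"
    using c by (simp add: shift_diff_def a_minus_def minus_add mult.commute a_comm)
qed

text \<open>For \<open>s = m\<close> and \<open>e = k\<close> the right side is the difference with
  step \<open>n\<close>, which kills every sequence of period \<open>n\<close>. Hence the difference
  with step \<open>m\<close> is nilpotent on such sequences.\<close>

lemma shift_diff_prime_power:
  "(\<And>i. c i \<in> carrier L) \<Longrightarrow> (shift_diff s ^^ (p ^ e)) c = shift_diff (s * p ^ e) c"
proof (induction e arbitrary: c)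
  case (Suc e)
  note outer = Suc.IH and cc = Suc.prems
  have *: "((shift_diff s ^^ (p ^ e)) ^^ j) c = (shift_diff (s * p ^ e) ^^ j) c" for j
  proof (induction j)
    case (Suc j)
    have "((shift_diff s ^^ (p ^ e)) ^^ Suc j) c = (shift_diff s ^^ (p ^ e)) ((shift_diff (s * p ^ e) ^^ j) c)"
      using Suc by simp
    also have "\<dots> = shift_diff (s * p ^ e) ((shift_diff (s * p ^ e) ^^ j) c)"
      by (intro outer shift_diff_funpow_closed cc)
    finally show ?case by simp
  qed simp
  have "(shift_diff s ^^ (p ^ Suc e)) c = ((shift_diff s ^^ (p ^ e)) ^^ p) c"
    by (simp add: funpow_mult mult.commute)
  also have "\<dots> = shift_diff (s * p ^ Suc e) c"
    using * shift_diff_prime[of c, OF cc] by (simp add: mult_ac)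
  finally show ?case .
qed (simp add: shift_diff_def)

end

section \<open>Resolvents and normal elements\<close>

locale resolvent_field = frobenius_field L p q r for L (structure) and p q r +
  fixes m k :: nat and \<omega>
  assumes m_pos: "m > 0" and m_coprime: "coprime m p" and root: "primitive_root m \<omega>"
begin

text \<open>On \<open>Fx n\<close> this is the relative trace down to \<open>Fx m\<close>, the
  Galois group of order \<open>p ^ k\<close> being generated by \<open>fr m\<close>.\<close>

definition trace :: "'a \<Rightarrow> 'a" where "trace x = (\<Oplus>t\<in>{..<p ^ k}. fr (m * t) x)"

text \<open>The Lagrange resolvent: the discrete Fourier transform modulo \<open>m\<close>, taken at
  \<open>j\<close>, of the sequence of conjugates.\<close>

definition res :: "nat \<Rightarrow> 'a \<Rightarrow> 'a" where "res j x = (\<Oplus>i\<in>{..<m}. \<omega> [^] (i * j) \<otimes> fr i x)"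

abbreviation (input) n :: nat where "n \<equiv> m * p ^ k"

lemma \<omega>_closed [simp]: "\<omega> \<in> carrier L"
  using root by (simp add: primitive_root_def)

lemma \<omega>_pow_eq_one: "\<omega> [^] (i::nat) = \<one> \<longleftrightarrow> m dvd i"
  using root by (simp add: primitive_root_def)

lemma \<omega>_cong: 
  assumes "[i = j] (mod m)" shows "\<omega> [^] (i::nat) = \<omega> [^] (j::nat)"
proof -
  have *: "\<omega> [^] i = \<omega> [^] (i mod m)" for i :: nat
  proof -
    have "\<omega> [^] i = \<omega> [^] (m * (i div m)) \<otimes> \<omega> [^] (i mod m)"
      by (simp add: nat_pow_mult)
    moreover have "\<omega> [^] (m * (i div m)) = \<one>" by (simp add: \<omega>_pow_eq_one)
    ultimately show ?thesis by simp
  qed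
  have "\<omega> [^] i = \<omega> [^] (i mod m)" by (rule *)
  also have "i mod m = j mod m" using assms by (simp add: cong_def)
  also have "\<omega> [^] (j mod m) = \<omega> [^] j" by (rule *[symmetric])
  finally show ?thesis .
qed

lemma \<omega>_pow_nonzero: "\<omega> [^] (i::nat) \<noteq> \<zero>"
proof
  assume "\<omega> [^] i = \<zero>"
  then have "\<omega> = \<zero>" by (rule nat_pow_eq_zero[rotated]) simp
  then show False using \<omega>_pow_eq_one[of m] m_pos by (simp add: nat_pow_zero)
qed

lemma m_nonzero: "[m] \<cdot> \<one> \<noteq> \<zero>"
  using m_coprime by (rule coprime_char_nonzero)

lemma mult_m_eq_zero: 
  assumes x: "x \<in> carrier L" and "[m] \<cdot> x = \<zero>" shows "x = \<zero>"
proof -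
  have "([m] \<cdot> \<one>) \<otimes> x = [m] \<cdot> (\<one> \<otimes> x)" using x by (subst add_pow_ldistr) auto
  then have "([m] \<cdot> \<one>) \<otimes> x = \<zero>" using assms by simp
  then show ?thesis using m_nonzero x integral_iff by (metis add.nat_pow_closed one_closed)
qed

lemma orthogonality: 
  "(\<Oplus>j\<in>{..<m}. \<omega> [^] (e * j)) = (if m dvd e then [m] \<cdot> \<one> else \<zero>)"
proof (cases "m dvd e")
  case True
  then have "(\<Oplus>j\<in>{..<m}. \<omega> [^] (e * j)) = (\<Oplus>j\<in>{..<m}. \<one>)"
    by (intro finsum_cong') (auto simp: \<omega>_pow_eq_one)
  then show ?thesis using True by (simp add: add.finprod_const)
next
  case False
  let ?x = "\<omega> [^] e"
  have "(?x \<ominus> \<one>) \<otimes> (\<Oplus>i\<in>{..<m}. ?x [^] i) = ?x [^] m \<ominus> \<one>"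
    by (rule geometric_finsum) simp
  also have "?x [^] m = \<one>" by (simp add: nat_pow_pow \<omega>_pow_eq_one)
  finally have "(?x \<ominus> \<one>) \<otimes> (\<Oplus>i\<in>{..<m}. ?x [^] i) = \<zero>" by simp
  moreover have "?x \<ominus> \<one> \<noteq> \<zero>" using False \<omega>_pow_eq_one[of e] by simp
  ultimately have "(\<Oplus>i\<in>{..<m}. ?x [^] i) = \<zero>"
    using integral[of "?x \<ominus> \<one>"] by (auto intro!: finsum_closed)
  then show ?thesis using False by (simp add: nat_pow_pow)
qed

lemma trace_closed [simp]: "x \<in> carrier L \<Longrightarrow> trace x \<in> carrier L"
  by (simp add: trace_def)

lemma res_closed [simp]: "x \<in> carrier L \<Longrightarrow> res j x \<in> carrier L"
  by (auto simp add: res_def intro!: finsum_closed)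

lemma trace_add: "x \<in> carrier L \<Longrightarrow> y \<in> carrier L \<Longrightarrow> trace (x \<oplus> y) = trace x \<oplus> trace y"
  unfolding trace_def by (subst finsum_addf[symmetric]) (auto simp: fr_add)

lemma trace_minus_cancel: 
  assumes "x \<in> carrier L" "y \<in> carrier L" "trace x = trace y" shows "trace (x \<ominus> y) = \<zero>"
proof -
  have "x = (x \<ominus> y) \<oplus> y" using assms(1-2) by (simp add: a_minus_def a_assoc l_neg)
  then have "trace x = trace (x \<ominus> y) \<oplus> trace y" using assms(1-2) trace_add[of "x \<ominus> y" y] by simp
  then show ?thesis using assms
    by (metis add.r_cancel_one' minus_closed trace_closed)
qed

lemma res_add: "x \<in> carrier L \<Longrightarrow> y \<in> carrier L \<Longrightarrow> res j (x \<oplus> y) = res j x \<oplus> res j y"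
  unfolding res_def by (subst finsum_addf[symmetric]) (auto simp: fr_add r_distr)

lemma res_finsum: 
  "finite A \<Longrightarrow> (\<And>a. a \<in> A \<Longrightarrow> f a \<in> carrier L) \<Longrightarrow> res j (\<Oplus>a\<in>A. f a) = (\<Oplus>a\<in>A. res j (f a))"
proof (induction A rule: finite_induct)
  case empty
  then show ?case unfolding res_def by (simp add: add.finprod_one_eqI)
next
  case (insert a A)
  then have "f \<in> A \<rightarrow> carrier L" by auto
  with insert show ?case by (simp add: res_add Pi_def)
qed

lemma trace_finsum: 
  "finite A \<Longrightarrow> (\<And>a. a \<in> A \<Longrightarrow> f a \<in> carrier L) \<Longrightarrow> trace (\<Oplus>a\<in>A. f a) = (\<Oplus>a\<in>A. trace (f a))"
proof (induction A rule: finite_induct)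
  case empty
  then show ?case unfolding trace_def by (simp add: add.finprod_one_eqI)
next
  case (insert a A)
  then have "f \<in> A \<rightarrow> carrier L" by auto
  with insert show ?case by (simp add: trace_add Pi_def)
qed

text \<open>Applying \<open>fr m\<close> moves the summation index by one, and the terms have period
  \<open>p ^ k\<close> in that index.\<close>

lemma trace_Fx: 
  assumes x: "x \<in> Fx n" shows "trace x \<in> Fx m"
proof -
  have xc: "x \<in> carrier L" using x by (rule Fx_carrier)
  have "fr m (trace x) = (\<Oplus>t\<in>{..<p ^ k}. fr (m * (t + 1)) x)"
    using xc unfolding trace_def by (subst fr_finsum) (auto simp: fr_fr)
  also have "\<dots> = trace x"
    unfolding trace_def
  proof (rule finsum_periodic_shift)
    fix t
    have "fr (m * (t + p ^ k)) x = fr (m * t + n) x" by (simp only: add_mult_distrib2)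
    then show "fr (m * (t + p ^ k)) x = fr (m * t) x" by (simp only: fr_period[OF x])
  qed (use xc in simp)
  finally show ?thesis using xc by (simp add: Fx_def)
qed

lemma trace_fr: "x \<in> carrier L \<Longrightarrow> trace (fr i x) = fr i (trace x)"
  unfolding trace_def by (subst fr_finsum) (auto simp: fr_fr add.commute)

lemma trace_scale: 
  assumes "c \<in> Fx 1" "x \<in> carrier L" shows "trace (c \<otimes> x) = c \<otimes> trace x"
proof -
  have c: "c \<in> carrier L" using assms by (simp add: Fx_carrier)
  show ?thesis unfolding trace_def using c assms
    by (subst finsum_rdistr) (auto simp: fr_mult fr_const)
qed

lemma res_scale: 
  assumes "c \<in> Fx 1" "x \<in> carrier L" shows "res j (c \<otimes> x) = c \<otimes> res j x"
proof -
  have c: "c \<in> carrier L" using assms by (simp add: Fx_carrier)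
  show ?thesis unfolding res_def using c assms
    by (subst finsum_rdistr) (auto simp: fr_mult fr_const m_ac)
qed

lemma res_cong: 
  assumes "[i = j] (mod m)" shows "res i x = res j x"
proof -
  have "\<omega> [^] (l * i) = \<omega> [^] (l * j)" for l :: nat
    using assms by (intro \<omega>_cong cong_scalar_left)
  then show ?thesis by (simp only: res_def)
qed

text \<open>On \<open>Fx m\<close> both factors of the summand have period \<open>m\<close>, so the
  summation may start anywhere.\<close>

lemma res_shift:
  assumes x: "x \<in> Fx m"
  shows "(\<Oplus>i\<in>{..<m}. \<omega> [^] ((i + t) * j) \<otimes> fr (i + t) x) = res j x"
proof -
  have xc: "x \<in> carrier L" using x by (rule Fx_carrier)
  define f where "f i = \<omega> [^] (i * j) \<otimes> fr i x" for i
  have "f (i + m) = f i" for i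
  proof -
    have "\<omega> [^] ((i + m) * j) = \<omega> [^] (i * j)"
      by (rule \<omega>_cong) (simp add: cong_def algebra_simps)
    then show ?thesis using fr_period[OF x] by (simp add: f_def)
  qed
  then have "(\<Oplus>i\<in>{..<m}. f (i + t)) = (\<Oplus>i\<in>{..<m}. f i)"
    using xc by (intro finsum_periodic_shift) (auto simp: f_def)
  then show ?thesis by (simp add: f_def res_def)
qed

text \<open>Frobenius moves the conjugates by \<open>t\<close> places and raises \<omega> to the
  power \<open>q ^ t\<close>, which turns the frequency \<open>j\<close> into
  \<open>j * q ^ t\<close>; the root of unity in front realigns the index. Resolvents along an orbit
  therefore determine each other.\<close>

lemma fr_res:
  assumes x: "x \<in> Fx m"
  shows "\<omega> [^] (t * (j * q ^ t)) \<otimes> fr t (res j x) = res (j * q ^ t) x"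
proof -
  have xc: "x \<in> carrier L" using x by (rule Fx_carrier)
  have "fr t (res j x) = (\<Oplus>i\<in>{..<m}. fr t (\<omega> [^] (i * j) \<otimes> fr i x))"
    unfolding res_def using xc by (intro fr_finsum) auto
  also have "\<dots> = (\<Oplus>i\<in>{..<m}. \<omega> [^] (i * (j * q ^ t)) \<otimes> fr (i + t) x)"
    using xc by (intro finsum_cong') (auto simp: fr_mult fr_fr add.commute fr_def[of t "\<omega> [^] _"] nat_pow_pow mult.assoc)
  finally have "\<omega> [^] (t * (j * q ^ t)) \<otimes> fr t (res j x) = 
     \<omega> [^] (t * (j * q ^ t)) \<otimes> (\<Oplus>i\<in>{..<m}. \<omega> [^] (i * (j * q ^ t)) \<otimes> fr (i + t) x)" by simp
  also have "\<dots> = (\<Oplus>i\<in>{..<m}. \<omega> [^] (t * (j * q ^ t)) \<otimes> (\<omega> [^] (i * (j * q ^ t)) \<otimes> fr (i + t) x))"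
    using xc by (intro finsum_rdistr) auto
  also have "\<dots> = (\<Oplus>i\<in>{..<m}. \<omega> [^] ((i + t) * (j * q ^ t)) \<otimes> fr (i + t) x)"
    using xc by (intro finsum_cong') (auto simp: m_assoc[symmetric] nat_pow_mult add_mult_distrib add.commute)
  also have "\<dots> = res (j * q ^ t) x" by (rule res_shift[OF x])
  finally show ?thesis .
qed

text \<open>Translating a sequence multiplies its Fourier transform by a character, here the power
  of \<omega> with exponent -ij. Exponents being natural numbers, \<open>m - 1\<close> stands for
  -1.\<close>

lemma res_fr:
  assumes x: "x \<in> Fx m"
  shows "res j (fr i x) = \<omega> [^] ((m - 1) * (i * j)) \<otimes> res j x"
proof -
  have xc: "x \<in> carrier L" using x by (rule Fx_carrier)
  have "\<omega> [^] ((m - 1) * (i * j)) \<otimes> res j x 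
     = \<omega> [^] ((m - 1) * (i * j)) \<otimes> (\<Oplus>l\<in>{..<m}. \<omega> [^] ((l + i) * j) \<otimes> fr (l + i) x)"
    by (simp add: res_shift[OF x])
  also have "\<dots> = (\<Oplus>l\<in>{..<m}. \<omega> [^] ((m - 1) * (i * j)) \<otimes> (\<omega> [^] ((l + i) * j) \<otimes> fr (l + i) x))"
    using xc by (intro finsum_rdistr) auto
  also have "\<dots> = (\<Oplus>l\<in>{..<m}. \<omega> [^] (l * j) \<otimes> fr l (fr i x))"
  proof (intro finsum_cong' refl)
    fix l assume "l \<in> {..<m}"
    have "(m - 1) * (i * j) + (l + i) * j = l * j + m * (i * j)"
      using m_pos by (cases m) (auto simp: algebra_simps)
    then have "\<omega> [^] ((m - 1) * (i * j) + (l + i) * j) = \<omega> [^] (l * j)"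
      by (intro \<omega>_cong) (simp add: cong_def)
    then show "\<omega> [^] ((m - 1) * (i * j)) \<otimes> (\<omega> [^] ((l + i) * j) \<otimes> fr (l + i) x) = \<omega> [^] (l * j) \<otimes> fr l (fr i x)"
      using xc by (simp add: m_assoc[symmetric] nat_pow_mult fr_fr)
  qed (use xc in auto)
  finally show ?thesis by (simp add: res_def)
qed

text \<open>Fourier inversion at index 0: orthogonality removes all conjugates except
  \<open>fr 0 x\<close>. As \<open>m\<close> is invertible in \<open>L\<close>, the resolvents
  determine \<open>x\<close>.\<close>

lemma res_sum:
  assumes x: "x \<in> carrier L" shows "(\<Oplus>j\<in>{..<m}. res j x) = [m] \<cdot> x"
proof -
  have "(\<Oplus>j\<in>{..<m}. res j x) = (\<Oplus>i\<in>{..<m}. \<Oplus>j\<in>{..<m}. \<omega> [^] (i * j) \<otimes> fr i x)"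
    unfolding res_def using x by (subst finsum_swap) auto
  also have "\<dots> = (\<Oplus>i\<in>{..<m}. (\<Oplus>j\<in>{..<m}. \<omega> [^] (i * j)) \<otimes> fr i x)"
    using x by (intro finsum_cong') (auto simp: finsum_ldistr Pi_def)
  also have "\<dots> = (\<Oplus>i\<in>{0}. (\<Oplus>j\<in>{..<m}. \<omega> [^] (i * j)) \<otimes> fr i x)"
    using x m_pos
    by (intro add.finprod_mono_neutral_cong_right) (auto simp: orthogonality dest: dvd_imp_le)
  also have "\<dots> = ([m] \<cdot> \<one>) \<otimes> x"
    using x orthogonality[of 0] by simp
  also have "\<dots> = [m] \<cdot> x" using x by (subst add_pow_ldistr) auto
  finally show ?thesis .
qed

lemma res_inj:
  assumes "x \<in> carrier L" "y \<in> carrier L" "\<And>j. j < m \<Longrightarrow> res j x = res j y"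
  shows "x = y"
proof -
  have "x = (x \<ominus> y) \<oplus> y" using assms(1-2) by (simp add: a_minus_def a_assoc l_neg)
  then have *: "res j x = res j (x \<ominus> y) \<oplus> res j y" for j 
    using assms(1-2) res_add[of "x \<ominus> y" y j] by simp
  have "res j (x \<ominus> y) = \<zero>" if "j < m" for j
    using *[of j] assms(1,2) assms(3)[OF that] by (metis add.r_cancel_one' minus_closed res_closed)
  then have s: "(\<Oplus>j\<in>{..<m}. res j (x \<ominus> y)) = \<zero>" by (intro add.finprod_one_eqI) simp
  have d: "x \<ominus> y \<in> carrier L" using assms(1,2) by (rule minus_closed)
  have "x \<ominus> y = \<zero>" using d trans[OF sym[OF res_sum[OF d]] s] by (rule mult_m_eq_zero)
  then show ?thesis using assms(1,2) by simp
qed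

text \<open>The trace is a polynomial in \<open>x\<close> with exponents \<open>q ^ (m * t)\<close>
  for \<open>t < p ^ k\<close>; the largest is \<open>q ^ (n - m)\<close>, which bounds the number
  of its roots.\<close>

lemma trace_kernel_card: "card {x \<in> carrier L. trace x = \<zero>} \<le> q ^ (n - m)"
  and trace_kernel_finite: "finite {x \<in> carrier L. trace x = \<zero>}"
proof -
  let ?h = "\<lambda>t. q ^ (m * t)" and ?d = "q ^ (n - m)"
  define c where "c e = (if e \<in> ?h ` {..<p ^ k} then \<one> else \<zero>)" for e
  have P: "p ^ k > 0" using prime_gt_0_nat[OF prime_p] by simp
  have nm: "n - m = m * (p ^ k - 1)" by (simp add: algebra_simps)
  have cl: "c e \<in> carrier L" for e by (simp add: c_def)
  have lead: "c ?d \<noteq> \<zero>" using P unfolding nm by (auto simp: c_def)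
  have inj: "inj_on ?h {..<p ^ k}"
    using q_gt_1 m_pos by (auto simp: inj_on_def)
  have sub: "?h ` {..<p ^ k} \<subseteq> {..?d}"
    using q_gt_1 unfolding nm by (auto intro!: power_increasing)
  have "(\<Oplus>e\<in>{..?d}. c e \<otimes> x [^] e) = trace x" if x: "x \<in> carrier L" for x
  proof -
    have "(\<Oplus>e\<in>{..?d}. c e \<otimes> x [^] e) = (\<Oplus>e\<in>?h ` {..<p ^ k}. x [^] e)"
      using x sub by (intro add.finprod_mono_neutral_cong_right) (auto simp: c_def)
    also have "\<dots> = (\<Oplus>t\<in>{..<p ^ k}. x [^] (q ^ (m * t)))"
      using x inj by (subst finsum_reindex) auto
    finally show ?thesis by (simp add: trace_def fr_def)
  qed
  then have "{x \<in> carrier L. (\<Oplus>e\<in>{..?d}. c e \<otimes> x [^] e) = \<zero>} = {x \<in> carrier L. trace x = \<zero>}"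
    by auto
  then show "card {x \<in> carrier L. trace x = \<zero>} \<le> q ^ (n - m)" "finite {x \<in> carrier L. trace x = \<zero>}"
    using finsum_roots_bound[of c, OF cl lead] by auto
qed

text \<open>Linear independence of the \<open>n\<close> conjugates over \<open>Fx 1\<close>. That
  they also span is derived by counting in \<open>normal_spans\<close>.\<close>

definition normal :: "'a \<Rightarrow> bool" where
  "normal x \<longleftrightarrow> (\<forall>c. (\<forall>i. c i \<in> Fx 1) \<and> (\<Oplus>i\<in>{..<n}. c i \<otimes> fr i x) = \<zero> \<longrightarrow> (\<forall>i<n. c i = \<zero>))"

text \<open>
  The case \<open>p | n\<close> is the delicate one: a relation \<open>c\<close> with vanishing transform need not vanish. But the
  shift by \<open>m\<close> acts unipotently on the relations, so if there is a nonzero relation there is one of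
  period \<open>m\<close>, to which Fourier inversion modulo \<open>m\<close> applies.
\<close>
lemma normalI:
  assumes x: "x \<in> Fx n" and good: "\<And>j. j < m \<Longrightarrow> res j (trace x) \<noteq> \<zero>"
  shows "normal x"
  unfolding normal_def
proof (intro allI impI, elim conjE, rule ccontr)
  fix c i0 assume c1: "\<forall>i. c i \<in> Fx 1" and sum0: "(\<Oplus>i\<in>{..<n}. c i \<otimes> fr i x) = \<zero>"
    and i0: "i0 < n" and nz: "c i0 \<noteq> \<zero>"
  have xc: "x \<in> carrier L" using x by (rule Fx_carrier)
  have cc: "c i \<in> carrier L" for i using c1 Fx_carrier by blast
  \<comment> \<open>The \<open>n\<close>-periodic relations among the conjugates form a space that
    will be seen to be stable under \<open>shift_diff m\<close>.\<close>
  define I where "I c \<longleftrightarrow> (\<forall>i. c i \<in> Fx 1) \<and> (\<forall>i. c (i + n) = c i) \<and> (\<Oplus>i\<in>{..<n}. c i \<otimes> fr i x) = \<zero>" for c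
  define c0 where "c0 i = c (i mod n)" for i
  have "(\<Oplus>i\<in>{..<n}. c0 i \<otimes> fr i x) = (\<Oplus>i\<in>{..<n}. c i \<otimes> fr i x)"
    using cc xc by (intro finsum_cong') (auto simp: c0_def)
  then have I0: "I c0" using c1 sum0 by (auto simp: I_def c0_def)
  have c0nz: "c0 i0 \<noteq> \<zero>" using nz i0 by (simp add: c0_def)
  have I_diff: "I (shift_diff m c)" if "I c" for c
  proof -
    have ci: "c i \<in> Fx 1" "c i \<in> carrier L" "c (i + n) = c i" for i
      using that unfolding I_def by (blast intro: Fx_carrier)+
    have s: "(\<Oplus>i\<in>{..<n}. c i \<otimes> fr i x) = \<zero>" using that by (simp add: I_def)
    \<comment> \<open>The left side of the relation translated by \<open>m\<close>. Its image under
      \<open>fr m\<close> is the original relation, read from another starting index, and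
      \<open>fr m\<close> sends only zero to zero.\<close>
    define u where "u = (\<Oplus>i\<in>{..<n}. c (i + m) \<otimes> fr i x)"
    have uc: "u \<in> carrier L" using ci xc by (auto simp: u_def intro!: finsum_closed)
    have "fr m u = (\<Oplus>i\<in>{..<n}. c (i + m) \<otimes> fr (i + m) x)"
      unfolding u_def using ci xc 
      by (subst fr_finsum) (auto simp: fr_mult fr_const fr_fr add.commute)
    also have "\<dots> = (\<Oplus>i\<in>{..<n}. c i \<otimes> fr i x)"
      using ci xc fr_period[OF x] finsum_periodic_shift[of "\<lambda>i. c i \<otimes> fr i x" n m] by simp
    finally have "u = \<zero>" using s uc fr_eq_zero_iff[of u m] by simp
    then have "(\<Oplus>i\<in>{..<n}. c (i + m) \<otimes> fr i x) \<ominus> (\<Oplus>i\<in>{..<n}. c i \<otimes> fr i x) = \<zero>"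
      using s by (simp add: u_def)
    moreover have "(\<Oplus>i\<in>{..<n}. c (i + m) \<otimes> fr i x) = 
        (\<Oplus>i\<in>{..<n}. shift_diff m c i \<otimes> fr i x) \<oplus> (\<Oplus>i\<in>{..<n}. c i \<otimes> fr i x)"
      using ci xc by (subst finsum_addf[symmetric])
        (auto intro!: finsum_cong' simp: shift_diff_def l_distr[symmetric] a_minus_def a_assoc l_neg)
    ultimately have "(\<Oplus>i\<in>{..<n}. shift_diff m c i \<otimes> fr i x) = \<zero>"
      using s ci xc by (auto simp: shift_diff_def intro!: finsum_closed)
    moreover have "shift_diff m c (i + n) = shift_diff m c i" for i
      using ci(3)[of i] ci(3)[of "i + m"] by (simp add: shift_diff_def add_ac)
    ultimately show ?thesis using ci by (auto simp: I_def shift_diff_def Fx_diff)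
  qed
  have Ij: "I ((shift_diff m ^^ j) c0)" for j
    by (induction j) (auto simp: I0 I_diff)
  have c0c: "c0 i \<in> carrier L" for i using I0 unfolding I_def by (blast intro: Fx_carrier)
  have "(shift_diff m ^^ (p ^ k)) c0 = shift_diff n c0"
    using c0c by (rule shift_diff_prime_power)
  also have "\<dots> = (\<lambda>_. \<zero>)" using I0 c0c by (auto simp: shift_diff_def I_def)
  finally have ex: "(shift_diff m ^^ (p ^ k)) c0 = (\<lambda>_. \<zero>)" .
  \<comment> \<open>The last nonzero iterate \<open>d\<close> is annihilated by one further
    difference, that is, it has period \<open>m\<close>.\<close>
  define j where "j = (LEAST j. (shift_diff m ^^ j) c0 = (\<lambda>_. \<zero>))"
  have j: "(shift_diff m ^^ j) c0 = (\<lambda>_. \<zero>)" unfolding j_def using ex by (rule LeastI)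
  have "j \<noteq> 0" using j c0nz by (metis funpow_0)
  then obtain j' where j': "j = Suc j'" by (cases j) auto
  define d where "d = (shift_diff m ^^ j') c0"
  have "d \<noteq> (\<lambda>_. \<zero>)" using not_less_Least[of j' "\<lambda>j. (shift_diff m ^^ j) c0 = (\<lambda>_. \<zero>)"]
    unfolding d_def j_def[symmetric] j' by simp
  then obtain i1 where i1: "d i1 \<noteq> \<zero>" by auto
  have Id: "I d" using Ij by (simp add: d_def)
  then have dF: "d i \<in> Fx 1" and dc: "d i \<in> carrier L" for i unfolding I_def by (blast intro: Fx_carrier)+
  have sd: "shift_diff m d = (\<lambda>_. \<zero>)" using j by (simp add: j' d_def)
  have per1: "d (i + m) = d i" for i
    using fun_cong[OF sd, of i] dc[of i] dc[of "i + m"] by (simp add: shift_diff_def)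
  have per: "d (m * t + i) = d i" for t i
  proof (induction t)
    case (Suc t)
    then show ?case using per1[of "m * t + i"] by (simp add: add_ac)
  qed simp
  define y where "y = trace x"
  have yF: "y \<in> Fx m" and yc: "y \<in> carrier L" using trace_Fx[OF x] by (auto simp: y_def Fx_carrier)
  \<comment> \<open>Since \<open>d\<close> has period \<open>m\<close>, summing over each residue
    class modulo \<open>m\<close> first turns the relation for \<open>x\<close> into one for its
    trace \<open>y\<close>.\<close>
  have "\<zero> = (\<Oplus>i\<in>{..<n}. d i \<otimes> fr i x)" using Id by (simp add: I_def)
  also have "\<dots> = (\<Oplus>t\<in>{..<p ^ k}. \<Oplus>i\<in>{..<m}. d (m * t + i) \<otimes> fr (m * t + i) x)"
    using dc xc by (subst finsum_mult_lessThan) auto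
  also have "\<dots> = (\<Oplus>i\<in>{..<m}. \<Oplus>t\<in>{..<p ^ k}. d (m * t + i) \<otimes> fr (m * t + i) x)"
    using dc xc by (intro finsum_swap) auto
  also have "\<dots> = (\<Oplus>i\<in>{..<m}. d i \<otimes> fr i y)"
  proof (intro finsum_cong' refl)
    fix i
    have "fr i y = (\<Oplus>t\<in>{..<p ^ k}. fr (m * t + i) x)"
      unfolding y_def trace_def using xc by (subst fr_finsum) (auto simp: fr_fr add.commute)
    then show "(\<Oplus>t\<in>{..<p ^ k}. d (m * t + i) \<otimes> fr (m * t + i) x) = d i \<otimes> fr i y"
      using dc xc by (simp add: per finsum_rdistr Pi_def)
  qed (use dc yc in auto)
  finally have s: "(\<Oplus>i\<in>{..<m}. d i \<otimes> fr i y) = \<zero>" by simp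
  \<comment> \<open>The \<open>j\<close>-th resolvent of the relation factors into the transform of
    \<open>d\<close> and the resolvent of \<open>y\<close>; the latter is nonzero.\<close>
  have hat: "(\<Oplus>i\<in>{..<m}. d i \<otimes> \<omega> [^] ((m - 1) * (i * j))) = \<zero>" if "j < m" for j
  proof -
    have "res j \<zero> = \<zero>" unfolding res_def by (simp add: add.finprod_one_eqI)
    then have "\<zero> = res j (\<Oplus>i\<in>{..<m}. d i \<otimes> fr i y)" using s by simp
    also have "\<dots> = (\<Oplus>i\<in>{..<m}. res j (d i \<otimes> fr i y))"
      using dc yc by (intro res_finsum) auto
    also have "\<dots> = (\<Oplus>i\<in>{..<m}. (d i \<otimes> \<omega> [^] ((m - 1) * (i * j))) \<otimes> res j y)"
      using dc dF yc yF by (intro finsum_cong') (auto simp: res_scale res_fr m_assoc)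
    also have "\<dots> = (\<Oplus>i\<in>{..<m}. d i \<otimes> \<omega> [^] ((m - 1) * (i * j))) \<otimes> res j y"
      using dc yc by (subst finsum_ldistr) auto
    finally have S0: "(\<Oplus>i\<in>{..<m}. d i \<otimes> \<omega> [^] ((m - 1) * (i * j))) \<otimes> res j y = \<zero>" by simp
    have Sc: "(\<Oplus>i\<in>{..<m}. d i \<otimes> \<omega> [^] ((m - 1) * (i * j))) \<in> carrier L"
      using dc by (intro finsum_closed) auto
    have "res j y \<noteq> \<zero>" using good[OF that] by (simp add: y_def)
    with integral[OF S0 Sc res_closed[OF yc]] show ?thesis by blast
  qed
  define i2 where "i2 = i1 mod m"
  have i2: "i2 < m" "d i2 \<noteq> \<zero>" 
    using i1 m_pos per[of "i1 div m" i2] by (auto simp: i2_def)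
  have dv: "m dvd (i2 + (m - 1) * i) \<longleftrightarrow> i = i2" if "i < m" for i
  proof -
    have e: "i2 + (m - 1) * i + i = i2 + m * i" using m_pos by (cases m) auto
    show ?thesis
    proof
      assume "m dvd i2 + (m - 1) * i"
      then obtain b where "i2 + (m - 1) * i = m * b" by auto
      then have "(m * b + i) mod m = (i2 + m * i) mod m" using e by simp
      then show "i = i2" using that i2(1) by simp
    next
      assume "i = i2"
      then have "i2 + (m - 1) * i = m * i2" using e by simp
      then show "m dvd i2 + (m - 1) * i" by simp
    qed
  qed
  \<comment> \<open>Fourier inversion at \<open>i2\<close>: orthogonality leaves only
    \<open>m\<close> times \<open>d i2\<close>, which is nonzero.\<close>
  have "\<zero> = (\<Oplus>j\<in>{..<m}. \<omega> [^] (i2 * j) \<otimes> (\<Oplus>i\<in>{..<m}. d i \<otimes> \<omega> [^] ((m - 1) * (i * j))))"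
    by (intro sym[OF add.finprod_one_eqI]) (simp only: lessThan_iff hat r_null nat_pow_closed \<omega>_closed)
  also have "\<dots> = (\<Oplus>j\<in>{..<m}. \<Oplus>i\<in>{..<m}. \<omega> [^] (i2 * j) \<otimes> (d i \<otimes> \<omega> [^] ((m - 1) * (i * j))))"
    using dc by (intro finsum_cong' refl) (auto simp: finsum_rdistr Pi_def)
  also have "\<dots> = (\<Oplus>j\<in>{..<m}. \<Oplus>i\<in>{..<m}. d i \<otimes> \<omega> [^] ((i2 + (m - 1) * i) * j))"
    using dc by (intro finsum_cong') (auto simp: m_lcomm nat_pow_mult algebra_simps)
  also have "\<dots> = (\<Oplus>i\<in>{..<m}. \<Oplus>j\<in>{..<m}. d i \<otimes> \<omega> [^] ((i2 + (m - 1) * i) * j))"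
    using dc by (intro finsum_swap) auto
  also have "\<dots> = (\<Oplus>i\<in>{..<m}. d i \<otimes> (\<Oplus>j\<in>{..<m}. \<omega> [^] ((i2 + (m - 1) * i) * j)))"
    using dc by (intro finsum_cong' refl) (auto simp: finsum_rdistr Pi_def)
  also have "\<dots> = (\<Oplus>i\<in>{i2}. d i \<otimes> (\<Oplus>j\<in>{..<m}. \<omega> [^] ((i2 + (m - 1) * i) * j)))"
    using dc i2 by (intro add.finprod_mono_neutral_cong_right) (auto simp: orthogonality dv[unfolded One_nat_def])
  also have "\<dots> = d i2 \<otimes> ([m] \<cdot> \<one>)"
    using dc i2 by (simp add: orthogonality dv[unfolded One_nat_def])
  finally have "d i2 \<otimes> ([m] \<cdot> \<one>) = \<zero>" by simp
  from integral[OF this dc] i2 m_nonzero show False by simp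
qed

end

lemma (in abelian_group) add_eq_right_imp_zero:
  "y = x \<oplus> y \<Longrightarrow> x \<in> carrier G \<Longrightarrow> y \<in> carrier G \<Longrightarrow> x = \<zero>"
  by (metis add.r_cancel_one')

section \<open>Counting the normal elements\<close>

context resolvent_field
begin

lemma res_eq_zero_orbit:
  assumes x: "x \<in> Fx m" and "[j = i * q ^ t] (mod m)"
  shows "res j x = \<zero> \<longleftrightarrow> res i x = \<zero>"
proof -
  have xc: "res i x \<in> carrier L" using x by (intro res_closed Fx_carrier)
  have "res j x = \<omega> [^] (t * (i * q ^ t)) \<otimes> fr t (res i x)"
    using res_cong[OF assms(2)] fr_res[OF x] by simp
  then show ?thesis
    using xc \<omega>_pow_nonzero integral_iff[of "\<omega> [^] (t * (i * q ^ t))" "fr t (res i x)"] fr_eq_zero_iff[OF xc]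
    by simp
qed

text \<open>Subtracting one element embeds a fibre of the trace into its kernel in \<open>L\<close>,
  of size at most \<open>q ^ (n - m)\<close>. With \<open>q ^ n\<close> elements upstairs and at
  most \<open>q ^ m\<close> downstairs, all bounds are attained.\<close>

lemma trace_fibres:
  assumes cardF: "card (Fx n) = q ^ n"
  shows "card (Fx m) = q ^ m"
    and "\<And>y. y \<in> Fx m \<Longrightarrow> card {x \<in> Fx n. trace x = y} = q ^ (n - m)"
proof -
  have P: "p ^ k > 0" using prime_gt_0_nat[OF prime_p] by simp
  then have mn: "m \<le> n" and n0: "n > 0" using m_pos by auto
  have *: "finite (Fx m)" "trace ` Fx n \<subseteq> Fx m" "finite (Fx n)" "card (Fx n) = q ^ m * q ^ (n - m)"
     "card (Fx m) \<le> q ^ m" "q ^ (n - m) > 0"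
    using Fx_finite[OF m_pos] Fx_finite[OF n0] trace_Fx cardF Fx_card[OF m_pos] q_gt_1 mn
    by (auto simp: power_add[symmetric])
  have le: "card {x \<in> Fx n. trace x = y} \<le> q ^ (n - m)" for y
  proof (cases "{x \<in> Fx n. trace x = y} = {}")
    case False
    then obtain x0 where x0: "x0 \<in> Fx n" "trace x0 = y" by blast
    have "card {x \<in> Fx n. trace x = y} \<le> card {x \<in> carrier L. trace x = \<zero>}"
    proof (rule card_inj_on_le)
      show "inj_on (\<lambda>x. x \<ominus> x0) {x \<in> Fx n. trace x = y}"
        using x0 by (auto simp: inj_on_def a_minus_def Fx_carrier dest!: Fx_carrier)
      show "(\<lambda>x. x \<ominus> x0) ` {x \<in> Fx n. trace x = y} \<subseteq> {x \<in> carrier L. trace x = \<zero>}"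
        using x0 Fx_carrier by (auto intro!: trace_minus_cancel)
    qed (rule trace_kernel_finite)
    then show ?thesis using trace_kernel_card by simp
  next
    case True
    then show ?thesis by (metis card.empty le0)
  qed
  show "card (Fx m) = q ^ m" by (rule fibre_count(1)[OF * le])
  show "\<And>y. y \<in> Fx m \<Longrightarrow> card {x \<in> Fx n. trace x = y} = q ^ (n - m)"
    by (rule fibre_count(2)[OF * le])
qed

text \<open>By independence the \<open>q ^ n\<close> combinations of conjugates are distinct, so
  they exhaust the field.\<close>

lemma normal_spans:
  assumes cardF: "card (Fx n) = q ^ n" and cardK: "card (Fx 1) = q"
    and x: "x \<in> Fx n" and nx: "normal x" and y: "y \<in> Fx n"
  shows "\<exists>c. (\<forall>i. c i \<in> Fx 1) \<and> y = (\<Oplus>i\<in>{..<n}. c i \<otimes> fr i x)"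
proof -
  have n0: "n > 0" using m_pos prime_gt_0_nat[OF prime_p] by simp
  have xc: "x \<in> carrier L" using x by (rule Fx_carrier)
  let ?C = "{..<n} \<rightarrow>\<^sub>E Fx 1" and ?f = "\<lambda>c. \<Oplus>i\<in>{..<n}. c i \<otimes> fr i x"
  have cF: "c i \<in> Fx 1" "c i \<in> carrier L" if "c \<in> ?C" "i < n" for c i
  proof -
    show "c i \<in> Fx 1" using that by (auto simp: PiE_def Pi_def)
    then show "c i \<in> carrier L" by (rule Fx_carrier)
  qed
  have inj: "inj_on ?f ?C"
  proof (rule inj_onI)
    fix c d assume cd: "c \<in> ?C" "d \<in> ?C" "?f c = ?f d"
    \<comment> \<open>Functions in \<open>?C\<close> are undefined from \<open>n\<close> on, whereas
      \<open>normal\<close> wants all coefficients in \<open>Fx 1\<close>; hence the value zero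
      there.\<close>
    define e where "e i = (if i < n then c i \<ominus> d i else \<zero>)" for i
    have z: "\<zero> \<in> Fx 1" by (simp add: Fx_def)
    have eF: "e i \<in> Fx 1" for i using cF cd Fx_diff z by (auto simp: e_def)
    then have ec: "e i \<in> carrier L" for i by (blast intro: Fx_carrier)
    have "?f c = ?f e \<oplus> ?f d"
    proof -
      have "?f e \<oplus> ?f d = (\<Oplus>i\<in>{..<n}. e i \<otimes> fr i x \<oplus> d i \<otimes> fr i x)"
        using ec cF cd xc by (intro sym[OF finsum_addf]) auto
      also have "\<dots> = ?f c"
      proof (intro finsum_cong' refl)
        fix i assume "i \<in> {..<n}"
        then show "e i \<otimes> fr i x \<oplus> d i \<otimes> fr i x = c i \<otimes> fr i x"
          using cF[OF cd(1), of i] cF[OF cd(2), of i] xc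
          by (simp add: e_def l_distr[symmetric]) (simp add: a_minus_def a_assoc l_neg)
      qed (use cF cd xc in auto)
      finally show ?thesis by simp
    qed
    moreover have "?f e \<in> carrier L" using ec xc by (intro finsum_closed) auto
    moreover have "?f d \<in> carrier L" using cF cd xc by (intro finsum_closed) auto
    ultimately have "?f e = \<zero>" unfolding cd(3) by (intro add_eq_right_imp_zero)
    then have "e i = \<zero>" if "i < n" for i using nx eF that unfolding normal_def by blast
    then have "c i = d i" if "i < n" for i using that cF cd by (auto simp: e_def)
    then show "c = d" using cd by (auto simp: PiE_def extensional_def fun_eq_iff) metis
  qed
  have "?f ` ?C \<subseteq> Fx n"
  proof safe
    fix c assume c: "c \<in> ?C"
    show "?f c \<in> Fx n"
      using cF[OF c] Fx_1_subset x by (intro Fx_finsum Fx_mult Fx_fr) auto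
  qed
  moreover have "card (?f ` ?C) = card (Fx n)"
    using inj cardF cardK by (simp add: card_image card_PiE)
  ultimately have "?f ` ?C = Fx n"
    using Fx_finite[OF n0] by (intro card_subset_eq) auto
  then obtain c where c: "c \<in> ?C" "y = ?f c" using y by blast
  define d where "d i = (if i < n then c i else \<zero>)" for i
  have "d i \<in> Fx 1" for i using cF c by (auto simp: d_def Fx_def)
  moreover have "?f c = ?f d"
    using cF c xc by (intro finsum_cong') (auto simp: d_def)
  ultimately show ?thesis using c by blast
qed

text \<open>By linearity and \<open>res_fr\<close>, a resolvent that vanishes at \<open>x\<close>
  vanishes on the whole span of its conjugates. This will give the converse of
  \<open>normalI\<close>.\<close>

lemma res_trace_combination:
  assumes c: "\<And>i. c i \<in> Fx 1" and x: "x \<in> Fx n" and z: "res j (trace x) = \<zero>"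
  shows "res j (trace (\<Oplus>i\<in>{..<n}. c i \<otimes> fr i x)) = \<zero>"
proof -
  have cc: "c i \<in> carrier L" for i using c by (rule Fx_carrier)
  have xc: "x \<in> carrier L" using x by (rule Fx_carrier)
  have "trace (\<Oplus>i\<in>{..<n}. c i \<otimes> fr i x) = (\<Oplus>i\<in>{..<n}. trace (c i \<otimes> fr i x))"
    using cc xc by (intro trace_finsum) auto
  then have "res j (trace (\<Oplus>i\<in>{..<n}. c i \<otimes> fr i x)) = (\<Oplus>i\<in>{..<n}. res j (trace (c i \<otimes> fr i x)))"
    using cc xc by (simp add: res_finsum)
  also have "\<dots> = \<zero>"
  proof (rule add.finprod_one_eqI)
    fix i
    have "trace (c i \<otimes> fr i x) = c i \<otimes> fr i (trace x)"
      using trace_scale[OF c, of "fr i x"] xc by (simp add: trace_fr)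
    then have "res j (trace (c i \<otimes> fr i x)) = c i \<otimes> res j (fr i (trace x))"
      using res_scale[OF c, of "fr i (trace x)"] xc by simp
    also have "\<dots> = \<zero>" using res_fr[OF trace_Fx[OF x]] z cc by simp
    finally show "res j (trace (c i \<otimes> fr i x)) = \<zero>" .
  qed
  finally show ?thesis .
qed

text \<open>\<open>Rep\<close> represents the orbits of multiplication by \<open>q\<close> modulo
  \<open>m\<close>, and \<open>kk i\<close> is an orbit length. The resolvents at \<open>Rep\<close>
  map \<open>Fx m\<close> bijectively onto a product of sets of size \<open>q ^ kk i\<close>;
  normality excludes zero in each coordinate, and each trace value has \<open>q ^ (n - m)\<close>
  preimages.\<close>

theorem card_normal:
  fixes Rep :: "nat set" and kk :: "nat \<Rightarrow> nat"
  assumes cardF: "card (Fx n) = q ^ n" and cardK: "card (Fx 1) = q"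
    and Rep: "finite Rep" "Rep \<subseteq> {..<m}"
    and cover: "\<And>j. j < m \<Longrightarrow> \<exists>i\<in>Rep. \<exists>t. [j = i * q ^ t] (mod m)"
    and kk: "\<And>i. i \<in> Rep \<Longrightarrow> kk i > 0" "\<And>i. i \<in> Rep \<Longrightarrow> [i * q ^ kk i = i] (mod m)"
    and kk_sum: "(\<Sum>i\<in>Rep. kk i) = m"
  shows "card {x \<in> Fx n. normal x} = q ^ (n - m) * (\<Prod>i\<in>Rep. q ^ kk i - 1)"
proof -
  have n0: "n > 0" using m_pos prime_gt_0_nat[OF prime_p] by simp
  \<comment> \<open>After \<open>kk i\<close> Frobenius steps the frequency is back at
    \<open>i\<close>, so \<open>fr_res\<close> becomes a twisted fixed point equation for the
    resolvent.\<close>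
  define Z where "Z i = {u \<in> carrier L. \<omega> [^] (kk i * (i * q ^ kk i)) \<otimes> u [^] (q ^ kk i) = u}" for i
  have Zfin: "finite (Z i)" and Zcard: "card (Z i) \<le> q ^ kk i" if "i \<in> Rep" for i
    using power_fixpoints_bound[of "\<omega> [^] (kk i * (i * q ^ kk i))" "q ^ kk i"] 
      kk(1)[OF that] \<omega>_pow_nonzero one_less_power[OF q_gt_1] unfolding Z_def by auto
  have resZ: "res i x \<in> Z i" if "i \<in> Rep" "x \<in> Fx m" for i x
    using fr_res[OF that(2), of "kk i" i] res_cong[OF kk(2)[OF that(1)], of x] Fx_carrier[OF that(2)]
    by (simp add: Z_def fr_def)
  define \<Phi> where "\<Phi> x = (\<lambda>i\<in>Rep. res i x)" for x
  note fib = trace_fibres[OF cardF]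
  have zero_iff: "(\<forall>j<m. res j x \<noteq> \<zero>) \<longleftrightarrow> (\<forall>i\<in>Rep. res i x \<noteq> \<zero>)" if "x \<in> Fx m" for x
    using res_eq_zero_orbit[OF that] cover Rep(2) by (metis lessThan_iff subsetD)
  have inj: "inj_on \<Phi> (Fx m)"
  proof (rule inj_onI)
    fix x y assume xy: "x \<in> Fx m" "y \<in> Fx m" "\<Phi> x = \<Phi> y"
    have R: "res i x = res i y" if "i \<in> Rep" for i
      using fun_cong[OF xy(3), of i] that by (simp add: \<Phi>_def)
    show "x = y"
    proof (rule res_inj)
      fix j assume "j < m"
      then obtain i t where it: "i \<in> Rep" "[j = i * q ^ t] (mod m)" using cover by blast
      then show "res j x = res j y"
        using res_cong[OF it(2)] fr_res[OF xy(1), of t i] fr_res[OF xy(2), of t i] R[OF it(1)] by simp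
    qed (use xy in \<open>auto simp: Fx_carrier\<close>)
  qed
  have sub: "\<Phi> ` Fx m \<subseteq> (\<Pi>\<^sub>E i\<in>Rep. Z i)" using resZ by (auto simp: \<Phi>_def)
  have Pfin: "finite (\<Pi>\<^sub>E i\<in>Rep. Z i)" using Rep Zfin by (intro finite_PiE) auto
  have cP: "card (\<Pi>\<^sub>E i\<in>Rep. Z i) = (\<Prod>i\<in>Rep. card (Z i))" using Rep by (simp add: card_PiE)
  have pq: "(\<Prod>i\<in>Rep. q ^ kk i) = q ^ m" by (simp add: power_sum[symmetric] kk_sum)
  have cPle: "(\<Prod>i\<in>Rep. card (Z i)) \<le> q ^ m"
    unfolding pq[symmetric] using Zcard by (intro prod_mono) auto
  \<comment> \<open>Injectivity gives this lower bound and the root count the same upper bound, so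
    \<Phi> is onto and no \<open>Z i\<close> is smaller than its bound.\<close>
  have "q ^ m \<le> card (\<Pi>\<^sub>E i\<in>Rep. Z i)"
    using card_mono[OF Pfin sub] fib(1) by (simp add: card_image[OF inj])
  with cP cPle have cPeq: "(\<Prod>i\<in>Rep. card (Z i)) = q ^ m" by simp
  have surj: "\<Phi> ` Fx m = (\<Pi>\<^sub>E i\<in>Rep. Z i)"
    using Pfin sub cP cPeq fib(1) by (intro card_subset_eq) (simp_all add: card_image[OF inj])
  have Zeq: "card (Z i) = q ^ kk i" if i: "i \<in> Rep" for i
  proof (rule ccontr)
    assume "card (Z i) \<noteq> q ^ kk i"
    then have lt: "card (Z i) < q ^ kk i" using Zcard[OF i] by simp
    have "(\<Prod>i\<in>Rep. card (Z i)) = card (Z i) * (\<Prod>i\<in>Rep - {i}. card (Z i))"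
      using Rep i by (intro prod.remove) auto
    also have "\<dots> \<le> card (Z i) * (\<Prod>i\<in>Rep - {i}. q ^ kk i)"
      using Zcard by (intro mult_left_mono prod_mono) auto
    also have "\<dots> < q ^ kk i * (\<Prod>i\<in>Rep - {i}. q ^ kk i)"
      using lt q_gt_1 by (intro mult_strict_right_mono prod_pos) auto
    also have "\<dots> = (\<Prod>i\<in>Rep. q ^ kk i)"
      using Rep i by (intro prod.remove[symmetric]) auto
    finally show False using cPeq pq by simp
  qed
  have Z0: "\<zero> \<in> Z i" if "i \<in> Rep" for i
    using q_gt_1 by (simp add: Z_def nat_pow_zero)
  define G where "G = {y \<in> Fx m. \<forall>i\<in>Rep. res i y \<noteq> \<zero>}"
  have "\<Phi> ` G = (\<Pi>\<^sub>E i\<in>Rep. Z i - {\<zero>})"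
  proof
    show "\<Phi> ` G \<subseteq> (\<Pi>\<^sub>E i\<in>Rep. Z i - {\<zero>})" using resZ by (auto simp: \<Phi>_def G_def)
    show "(\<Pi>\<^sub>E i\<in>Rep. Z i - {\<zero>}) \<subseteq> \<Phi> ` G"
    proof
      fix u assume u: "u \<in> (\<Pi>\<^sub>E i\<in>Rep. Z i - {\<zero>})"
      then have "u \<in> \<Phi> ` Fx m" unfolding surj by (auto simp: PiE_def Pi_def)
      then obtain y where y: "y \<in> Fx m" "u = \<Phi> y" by blast
      have "res i y \<noteq> \<zero>" if "i \<in> Rep" for i using u that unfolding y(2) \<Phi>_def by (auto simp: PiE_def Pi_def)
      then show "u \<in> \<Phi> ` G" using y by (auto simp: G_def)
    qed
  qed
  moreover have "inj_on \<Phi> G" using inj by (rule inj_on_subset) (auto simp: G_def)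
  ultimately have "card G = card (\<Pi>\<^sub>E i\<in>Rep. Z i - {\<zero>})" using card_image by metis
  also have "\<dots> = (\<Prod>i\<in>Rep. q ^ kk i - 1)"
    using Rep Zeq Z0 Zfin by (simp add: card_PiE card_Diff_singleton)
  finally have cG: "card G = (\<Prod>i\<in>Rep. q ^ kk i - 1)" .
  have Gfin: "finite G" using Fx_finite[OF m_pos] by (simp add: G_def)
  have pre: "card {x \<in> Fx n. trace x \<in> G} = q ^ (n - m) * (\<Prod>i\<in>Rep. q ^ kk i - 1)"
  proof -
    have "{x \<in> Fx n. trace x \<in> G} = (\<Union>y\<in>G. {x \<in> Fx n. trace x = y})" by auto
    moreover have "card (\<Union>y\<in>G. {x \<in> Fx n. trace x = y}) = (\<Sum>y\<in>G. card {x \<in> Fx n. trace x = y})"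
      using Gfin Fx_finite[OF n0] by (intro card_UN_disjoint) auto
    ultimately have "card {x \<in> Fx n. trace x \<in> G} = (\<Sum>y\<in>G. card {x \<in> Fx n. trace x = y})" by simp
    also have "\<dots> = (\<Sum>y\<in>G. q ^ (n - m))" using fib(2) by (intro sum.cong) (auto simp: G_def)
    finally show ?thesis using cG by simp
  qed
  have "q ^ kk i - 1 > 0" if "i \<in> Rep" for i using one_less_power[OF q_gt_1 kk(1)[OF that]] by simp
  then have "(\<Prod>i\<in>Rep. q ^ kk i - 1) > 0" by (intro prod_pos) auto
  \<comment> \<open>An element \<open>y\<close> all of whose resolvents are nonzero exists because
    its kind has been counted.\<close>
  then have "card {x \<in> Fx n. trace x \<in> G} > 0" unfolding pre using q_gt_1 by simp
  then have "{x \<in> Fx n. trace x \<in> G} \<noteq> {}" by (metis card.empty less_irrefl)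
  then obtain y where y: "y \<in> Fx n" "trace y \<in> G" by blast
  have "normal x \<longleftrightarrow> trace x \<in> G" if x: "x \<in> Fx n" for x
  proof
    assume "trace x \<in> G"
    then show "normal x"
      using normalI[OF x] zero_iff[OF trace_Fx[OF x]] by (auto simp: G_def)
  next
    assume nx: "normal x"
    \<comment> \<open>The conjugates of a normal \<open>x\<close> span \<open>y\<close>, which would
      inherit any vanishing resolvent of \<open>x\<close>.\<close>
    obtain c where c: "\<forall>i. c i \<in> Fx 1" "y = (\<Oplus>i\<in>{..<n}. c i \<otimes> fr i x)"
      using normal_spans[OF cardF cardK x nx y(1)] by blast
    have "res i (trace x) \<noteq> \<zero>" if "i \<in> Rep" for i
      using res_trace_combination[of c x i] c x y(2) that by (auto simp: G_def)
    then show "trace x \<in> G" using trace_Fx[OF x] by (auto simp: G_def)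
  qed
  then have "{x \<in> Fx n. normal x} = {x \<in> Fx n. trace x \<in> G}" by blast
  then show ?thesis using pre by simp
qed

end

section \<open>Orbits of multiplication by \<open>q\<close> modulo \<open>m\<close>\<close>

text \<open>\<open>m div gcd j m\<close> is the additive order of \<open>j\<close> modulo
  \<open>m\<close>, and a cyclic group has \<open>totient d\<close> elements of order
  \<open>d\<close>.\<close>

lemma card_gcd_eq_lessThan:
  fixes m :: nat
  assumes "m > 0" "d dvd m"
  shows "card {j. j < m \<and> m div gcd j m = d} = totient d"
proof -
  have d0: "d > 0" using assms by (auto intro: Nat.gr0I)
  have *: "m div gcd j m = d \<longleftrightarrow> gcd j m = m div d" for j
  proof -
    obtain e where e: "m = gcd j m * e" using gcd_dvd2 dvdE by blast
    obtain d' where d': "m = d * d'" using assms by auto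
    have "m div gcd j m = e" using e assms by (metis gcd_pos_nat nonzero_mult_div_cancel_left less_not_refl)
    moreover have "m div d = d'" using d' d0 by simp
    moreover have "e = d \<longleftrightarrow> gcd j m = d'"
      using e d' d0 assms by (metis mult.commute mult_cancel_right mult_eq_0_iff less_not_refl)
    ultimately show ?thesis by simp
  qed
  have "card {j. j < m \<and> m div gcd j m = d} = card {j\<in>{0<..m}. gcd j m = m div d}"
  proof (rule bij_betw_same_card[symmetric])
    \<comment> \<open>The totient count ranges over \<open>{0<..m}\<close>, where \<open>m\<close>
      stands for the residue 0.\<close>
    show "bij_betw (\<lambda>j. j mod m) {j\<in>{0<..m}. gcd j m = m div d} {j. j < m \<and> m div gcd j m = d}"
      unfolding *
    proof (rule bij_betw_byWitness[where f' = "\<lambda>j. if j = 0 then m else j"])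
      show "\<forall>j\<in>{j \<in> {0<..m}. gcd j m = m div d}. (if j mod m = 0 then m else j mod m) = j"
        by (auto simp: le_less)
    qed (use assms in \<open>auto simp: le_less split: if_splits\<close>)
  qed
  also have "\<dots> = totient (m div (m div d))"
    using assms by (intro card_gcd_eq_totient) (auto simp: div_dvd_iff_mult)
  also have "m div (m div d) = d" using assms by (auto simp: div_div_eq_right)
  finally show ?thesis .
qed

text \<open>Dividing by the gcd leaves a unit times powers of \<open>q\<close> modulo
  \<open>m div gcd j m\<close>. So the orbit of \<open>j\<close> has length
  \<open>ord (m div gcd j m) q\<close>.\<close>

lemma mult_power_cong_iff:
  fixes m q j s t :: nat
  assumes "coprime m q" "m > 0"
  shows "[j * q ^ s = j * q ^ t] (mod m) \<longleftrightarrow> [s = t] (mod ord (m div gcd j m) q)"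
proof -
  define g where "g = gcd j m"
  have g: "g > 0" using assms by (simp add: g_def)
  define d where "d = m div g"
  obtain j' where j': "j = g * j'" unfolding g_def by (metis dvdE gcd_dvd1)
  have m: "m = g * d" unfolding d_def g_def by (rule dvd_mult_div_cancel[OF gcd_dvd2, symmetric])
  have "gcd (g * j') (g * d) = g" unfolding j'[symmetric] m[symmetric] by (rule g_def[symmetric])
  then have "coprime j' d" using g by (simp add: gcd_mult_distrib_nat[symmetric] coprime_iff_gcd_eq_1)
  have "coprime d q" using assms(1) unfolding m by simp
  have "[j * q ^ s = j * q ^ t] (mod m) \<longleftrightarrow> [j' * q ^ s = j' * q ^ t] (mod d)"
    using g unfolding j' m cong_def by (simp add: mult.assoc mult_mod_right[symmetric])
  also have "\<dots> \<longleftrightarrow> [q ^ s = q ^ t] (mod d)"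
    using \<open>coprime j' d\<close> by (rule cong_mult_lcancel_nat)
  also have "\<dots> \<longleftrightarrow> [s = t] (mod ord d q)"
    using \<open>coprime d q\<close> by (rule order_divides_expdiff)
  finally show ?thesis by (simp add: d_def g_def)
qed

text \<open>Each orbit is represented by its minimum. As \<open>q\<close> is a unit modulo
  \<open>m\<close>, \<open>D\<close> is constant on orbits, so the \<open>totient d\<close> residues
  with \<open>D j = d\<close> split into orbits of length \<open>ord d q\<close>.\<close>

lemma orbit_representatives:
  fixes m q :: nat
  assumes cop: "coprime m q" and m: "m > 0"
  defines "D \<equiv> \<lambda>j. m div gcd j m"
  obtains Rep where "finite Rep" "Rep \<subseteq> {..<m}"
    "\<And>j. j < m \<Longrightarrow> \<exists>i\<in>Rep. \<exists>t. [j = i * q ^ t] (mod m)"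
    "\<And>d. d dvd m \<Longrightarrow> card {i \<in> Rep. D i = d} * ord d q = totient d"
proof -
  define orb where "orb j = (\<lambda>t. j * q ^ t mod m) ` UNIV" for j
  have D_dvd: "D j dvd m" for j unfolding D_def by (simp add: div_dvd_iff_mult m)
  have D_pos: "D j > 0" for j using D_dvd[of j] m by (auto intro: Nat.gr0I)
  have copD: "coprime (D j) q" for j using D_dvd cop by (meson coprime_divisors dvd_refl)
  have o_pos: "ord (D j) q > 0" for j using copD by simp
  have iff: "j * q ^ s mod m = j * q ^ t mod m \<longleftrightarrow> s mod ord (D j) q = t mod ord (D j) q" for j s t
    using mult_power_cong_iff[OF cop m, of j s t] by (simp add: cong_def D_def)
  have orb_eq: "orb j = (\<lambda>t. j * q ^ t mod m) ` {..<ord (D j) q}" for j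
  proof -
    have "x \<in> (\<lambda>t. j * q ^ t mod m) ` {..<ord (D j) q}" if xj: "x \<in> orb j" for x
    proof -
      obtain t where "x = j * q ^ t mod m" using xj by (auto simp: orb_def)
      then have "x = j * q ^ (t mod ord (D j) q) mod m" by (simp add: iff)
      then show ?thesis using o_pos[of j] by (intro image_eqI[of _ _ "t mod ord (D j) q"]) simp_all
    qed
    then show ?thesis by (auto simp: orb_def)
  qed
  have orb_card: "card (orb j) = ord (D j) q" for j
  proof -
    have "inj_on (\<lambda>t. j * q ^ t mod m) {..<ord (D j) q}" by (auto simp: inj_on_def iff)
    then show ?thesis unfolding orb_eq by (simp add: card_image)
  qed
  have orb_fin: "finite (orb j)" for j by (simp add: orb_eq)
  have orb_less: "i < m" if "i \<in> orb j" for i j using that m by (auto simp: orb_def)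
  have self: "j \<in> orb j" if "j < m" for j using that by (auto simp: orb_def intro!: image_eqI[of _ _ 0])
  have orb_mod: "orb (j mod m) = orb j" for j by (simp add: orb_def mod_mult_left_eq)
  have orb_sub: "orb i \<subseteq> orb j" if ij: "i \<in> orb j" for i j
  proof
    fix x assume "x \<in> orb i"
    then obtain s where s: "x = i * q ^ s mod m" by (auto simp: orb_def)
    obtain t where "i = j * q ^ t mod m" using ij by (auto simp: orb_def)
    then have "x = j * q ^ (t + s) mod m" using s by (simp add: mod_mult_left_eq power_add mult.assoc)
    then show "x \<in> orb j" by (auto simp: orb_def)
  qed
  have sym: "j \<in> orb i" if ij: "i \<in> orb j" "j < m" for i j
  proof -
    obtain t where t: "i = j * q ^ t mod m" using ij by (auto simp: orb_def)
    \<comment> \<open>Multiplying by \<open>q ^ s\<close> undoes \<open>q ^ t\<close>, because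
      \<open>t + s\<close> is a multiple of the orbit length.\<close>
    define s where "s = t * (ord (D j) q - 1)"
    have "t + s = ord (D j) q * t" using o_pos[of j] by (cases "ord (D j) q") (auto simp: s_def)
    then have "j * q ^ (t + s) mod m = j * q ^ 0 mod m" unfolding iff by simp
    then have "j = i * q ^ s mod m" using that t by (simp add: mod_mult_left_eq power_add mult.assoc)
    then show ?thesis by (auto simp: orb_def)
  qed
  have eq: "orb i = orb j" if "i \<in> orb j" "j < m" for i j
    using orb_sub that sym by blast
  have D_eq: "D i = D j" if ij: "i \<in> orb j" for i j
  proof -
    obtain t where t: "i = j * q ^ t mod m" using ij by (auto simp: orb_def)
    have "gcd i m = gcd (j * q ^ t) m"
      using gcd_red_nat[of "j * q ^ t" m] by (simp only: t gcd.commute)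
    also have "\<dots> = gcd j m"
      using cop by (intro gcd_mult_left_right_cancel) simp
    finally show ?thesis by (simp add: D_def)
  qed
  define Rep where "Rep = {j. j < m \<and> j = Min (orb j)}"
  have rep: "Min (orb j) \<in> Rep \<and> Min (orb j) \<in> orb j" if "j < m" for j
  proof -
    have "Min (orb j) \<in> orb j" using orb_fin self[OF that] by (intro Min_in) auto
    then show ?thesis using eq[OF _ that] orb_less that by (auto simp: Rep_def)
  qed
  show ?thesis
  proof (rule that)
    show "finite Rep" "Rep \<subseteq> {..<m}" by (auto simp: Rep_def)
    show "\<exists>i\<in>Rep. \<exists>t. [j = i * q ^ t] (mod m)" if "j < m" for j
    proof -
      have "j \<in> orb (Min (orb j))" using sym rep that by blast
      then obtain t where "j = Min (orb j) * q ^ t mod m" unfolding orb_def by blast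
      then have "[j = Min (orb j) * q ^ t] (mod m)" by (metis cong_def mod_mod_trivial)
      then show ?thesis using rep[OF that] by blast
    qed
    fix d assume d: "d dvd m"
    have "{j. j < m \<and> D j = d} = (\<Union>i\<in>{i\<in>Rep. D i = d}. orb i)"
    proof (intro equalityI subsetI)
      fix j assume j: "j \<in> {j. j < m \<and> D j = d}"
      then have "j \<in> orb (Min (orb j))" "D (Min (orb j)) = d" using sym rep D_eq by auto
      then show "j \<in> (\<Union>i\<in>{i\<in>Rep. D i = d}. orb i)" using rep j by blast
    qed (use D_eq orb_less in blast)
    moreover have "card (\<Union>i\<in>{i\<in>Rep. D i = d}. orb i) = (\<Sum>i\<in>{i\<in>Rep. D i = d}. card (orb i))"
    proof (rule card_UN_disjoint)
      show "finite {i\<in>Rep. D i = d}" by (simp add: Rep_def)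
      show "\<forall>i\<in>{i\<in>Rep. D i = d}. finite (orb i)" using orb_fin by blast
      have "i = j" if "i \<in> Rep" "j \<in> Rep" "x \<in> orb i" "x \<in> orb j" for i j x
      proof -
        have "orb i = orb j" using eq[of x i] eq[of x j] that by (auto simp: Rep_def)
        then show ?thesis using that by (auto simp: Rep_def)
      qed
      then show "\<forall>i\<in>{i\<in>Rep. D i = d}. \<forall>j\<in>{i\<in>Rep. D i = d}. i \<noteq> j \<longrightarrow> orb i \<inter> orb j = {}" by blast
    qed
    moreover have "card {j. j < m \<and> D j = d} = totient d"
      unfolding D_def by (rule card_gcd_eq_lessThan[OF m d])
    moreover have "(\<Sum>i\<in>{i\<in>Rep. D i = d}. card (orb i)) = card {i\<in>Rep. D i = d} * ord d q"
      by (simp add: orb_card)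
    ultimately show "card {i \<in> Rep. D i = d} * ord d q = totient d" by simp
  qed
qed

section \<open>The product formula for the normal density\<close>

lemma (in field) finite_field_power_eq:
  assumes "order R = Q" "Q > 1" "x \<in> carrier R"
  shows "x [^] Q = x"
proof (cases "x = \<zero>")
  case False
  have fin: "finite (carrier R)" using assms by (auto simp: order_def intro: card_ge_0_finite)
  interpret M: group "Multiplicative_Group.mult_of R" by (rule field_mult_group)
  have "x [^]\<^bsub>Multiplicative_Group.mult_of R\<^esub> order (Multiplicative_Group.mult_of R) = \<one>\<^bsub>Multiplicative_Group.mult_of R\<^esub>"
    using False assms by (intro M.pow_order_eq_1) auto
  then have "x [^] (Q - 1) = \<one>"
    using assms order_mult_of[OF fin] by (simp add: Multiplicative_Group.nat_pow_mult_of)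
  then have "x [^] Suc (Q - 1) = x" using assms(3) by (simp only: nat_pow_Suc l_one)
  also have "Suc (Q - 1) = Q" using assms(2) by simp
  finally show ?thesis .
qed (use assms in \<open>simp add: nat_pow_zero\<close>)

lemma (in ring) combine_map_upt:
  fixes c u :: "nat \<Rightarrow> 'a"
  shows "(\<And>i. i < n \<Longrightarrow> c i \<in> carrier R) \<Longrightarrow> (\<And>i. i < n \<Longrightarrow> u i \<in> carrier R) \<Longrightarrow>
    combine (map c [0..<n]) (map u [0..<n]) = (\<Oplus>i\<in>{..<n}. c i \<otimes> u i)"
proof (induction n arbitrary: c u)
  case (Suc n)
  have *: "map f [0..<Suc n] = f 0 # map (\<lambda>i. f (Suc i)) [0..<n]" for f :: "nat \<Rightarrow> 'a"
    by (simp add: upt_conv_Cons map_Suc_upt[symmetric] comp_def del: upt_Suc)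
  have "{..<Suc n} = insert 0 (Suc ` {..<n})" by (simp add: lessThan_Suc_eq_insert_0)
  then have "(\<Oplus>i\<in>{..<Suc n}. c i \<otimes> u i) = c 0 \<otimes> u 0 \<oplus> (\<Oplus>i\<in>Suc ` {..<n}. c i \<otimes> u i)"
    using Suc.prems by (simp only:, subst finsum_insert) auto
  also have "(\<Oplus>i\<in>Suc ` {..<n}. c i \<otimes> u i) = (\<Oplus>i\<in>{..<n}. c (Suc i) \<otimes> u (Suc i))"
    using Suc.prems by (subst finsum_reindex) (auto simp: Pi_def)
  also have "\<dots> = combine (map (\<lambda>i. c (Suc i)) [0..<n]) (map (\<lambda>i. u (Suc i)) [0..<n])"
    using Suc.prems by (intro Suc.IH[symmetric]) auto
  finally show ?case unfolding * by simp
qed simp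

text \<open>Lagrange's theorem in the additive group kills the multiple \<open>p ^ N\<close> of
  \<open>\<one>\<close>, which is the \<open>N\<close>-th power of the multiple \<open>p\<close>; a
  domain has no nilpotents.\<close>

lemma (in cring) char_of_prime_power_order:
  assumes "domain R" "order R = p ^ N"
  shows "[p] \<cdot> \<one> = \<zero>"
proof -
  interpret domain R by fact
  have *: "[(p ^ j)] \<cdot> \<one> = ([p] \<cdot> \<one>) [^] j" for j :: nat
  proof (induction j)
    case (Suc j)
    have "[(p ^ Suc j)] \<cdot> \<one> = [p] \<cdot> ([(p ^ j)] \<cdot> \<one>)"
      by (simp add: add.nat_pow_pow mult.commute)
    also have "\<dots> = [p] \<cdot> (([(p ^ j)] \<cdot> \<one>) \<otimes> \<one>)" by simp
    also have "\<dots> = ([(p ^ j)] \<cdot> \<one>) \<otimes> ([p] \<cdot> \<one>)"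
      by (rule add_pow_rdistr[symmetric]) auto
    finally show ?case using Suc by simp
  qed simp
  have "[order (add_monoid R)] \<cdot> \<one> = \<zero>"
    using add.pow_order_eq_1[of \<one>] by (simp add: add_pow_def)
  then have "[(p ^ N)] \<cdot> \<one> = \<zero>" using assms(2) by (simp add: order_def)
  then have "([p] \<cdot> \<one>) [^] N = \<zero>" using * by simp
  then show ?thesis by (rule nat_pow_eq_zero[rotated]) simp
qed

text \<open>Inside the algebraic closure, \<open>F\<close> and \<open>K\<close> become
  \<open>Fx n\<close> and \<open>Fx 1\<close>, and normality becomes \<open>R.normal\<close>. The
  product over orbits in \<open>card_normal\<close> is then sorted by
  \<open>d = D i\<close>.\<close>

theorem normal_density_formula:
  fixes F :: "('a, 'm) ring_scheme" and K :: "'a set"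
  assumes q: "primepow q" and n: "n > 0"
    and F: "field F" "order F = q ^ n" and K: "subfield K F" "card K = q"
  shows "normal_density F K n =
    (\<Prod>d | d dvd n \<and> coprime d q. (1 - 1 / real q ^ ord d q) ^ (totient d div ord d q))"
proof -
  interpret F: field F by (rule F(1))
  obtain p r where pr: "prime p" "r > 0" "q = p ^ r" using q by (auto simp: primepow_def)
  have p1: "p > 1" using pr(1) by (rule prime_gt_1_nat)
  have q1: "q > 1" unfolding pr(3) using p1 pr(2) by (rule one_less_power)
  obtain m where m: "n = p ^ multiplicity p n * m" "\<not> p dvd m"
    using multiplicity_decompose'[of n p] n p1 by auto
  define k where "k = multiplicity p n"
  have nmk: "n = m * p ^ k" using m(1) unfolding k_def by (simp only: mult.commute)
  have m0: "m > 0" using n nmk by (auto intro: Nat.gr0I)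
  have mp: "coprime m p" using prime_imp_coprime[OF pr(1) m(2)] by (rule coprime_commute[THEN iffD1])
  have mq: "coprime m q" using mp unfolding pr(3) by simp

  define L where "L = F.alg_closure"
  define h where "h = (F.indexed_const :: 'a \<Rightarrow> ('a list \<times> nat) multiset \<Rightarrow> 'a)"
  interpret AC: algebraic_closure L "h ` carrier F"
    unfolding L_def h_def by (rule F.alg_closureE(1))
  have hom: "h \<in> ring_hom F L" unfolding L_def h_def by (rule F.alg_closureE(2))
  have h_inj: "inj_on h (carrier F)" unfolding h_def by (rule F.indexed_const_inj_on)
  interpret H: ring_hom_cring F L h
    using hom by unfold_locales
  have "[p] \<cdot>\<^bsub>F\<^esub> \<one>\<^bsub>F\<^esub> = \<zero>\<^bsub>F\<^esub>"
    using F.char_of_prime_power_order[of p "r * n"] F.domain_axioms F(2) by (simp add: pr(3) power_mult)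
  moreover have "h ([j] \<cdot>\<^bsub>F\<^esub> \<one>\<^bsub>F\<^esub>) = [j] \<cdot>\<^bsub>L\<^esub> \<one>\<^bsub>L\<^esub>" for j :: nat
    by (induction j) auto
  ultimately have "[p] \<cdot>\<^bsub>L\<^esub> \<one>\<^bsub>L\<^esub> = \<zero>\<^bsub>L\<^esub>" by (metis H.hom_zero)
  then interpret C: alg_closed_char L p
    using pr(1) by unfold_locales
  obtain \<omega> where \<omega>: "AC.primitive_root m \<omega>" using C.primitive_root_exists[OF mp m0] by blast
  interpret R: resolvent_field L p q r m k \<omega>
    using pr(2,3) m0 mp \<omega> by unfold_locales auto

  have qn: "q ^ n > 1" using q1 n by (rule one_less_power)
  \<comment> \<open>The image consists of \<open>q ^ n\<close> fixed points, and there are at most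
    that many.\<close>
  have hF: "h ` carrier F = R.Fx n"
  proof (rule card_seteq)
    show "finite (R.Fx n)" using n by (rule R.Fx_finite)
    show "h ` carrier F \<subseteq> R.Fx n"
    proof safe
      fix x assume x: "x \<in> carrier F"
      then have "h (x [^]\<^bsub>F\<^esub> (q ^ n)) = h x" using F.finite_field_power_eq[OF F(2) qn] by simp
      then show "h x \<in> R.Fx n" using x by (simp add: R.Fx_def R.fr_def)
    qed
    show "card (R.Fx n) \<le> card (h ` carrier F)"
      using F(2) h_inj R.Fx_card[OF n] by (simp add: card_image order_def)
  qed
  have Ksub: "K \<subseteq> carrier F" using K(1) by (rule subfieldE(3))
  have hK: "h ` K = R.Fx 1"
  proof (rule card_seteq)
    show "finite (R.Fx 1)" by (rule R.Fx_finite) simp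
    show "h ` K \<subseteq> R.Fx 1"
    proof safe
      fix x assume x: "x \<in> K"
      have "field (F\<lparr>carrier := K\<rparr>)" using K(1) by (rule F.subfield_iff(2))
      then have "x [^]\<^bsub>F\<lparr>carrier := K\<rparr>\<^esub> q = x"
        using x K(2) q1 by (intro field.finite_field_power_eq) (auto simp: order_def)
      then have "x [^]\<^bsub>F\<^esub> q = x" by (simp add: nat_pow_def)
      then have "h (x [^]\<^bsub>F\<^esub> q) = h x" by simp
      then show "h x \<in> R.Fx 1" using x Ksub by (auto simp add: R.Fx_def R.fr_def)
    qed
    show "card (R.Fx 1) \<le> card (h ` K)"
      using K(2) inj_on_subset[OF h_inj Ksub] R.Fx_card[of 1] by (simp add: card_image)
  qed
  have cardF: "card (R.Fx n) = q ^ n"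
    using F(2) h_inj unfolding hF[symmetric] by (simp add: card_image order_def)
  have cardK: "card (R.Fx 1) = q"
    using K(2) inj_on_subset[OF h_inj Ksub] unfolding hK[symmetric] by (simp add: card_image)

  define u where "u \<beta> i = \<beta> [^]\<^bsub>F\<^esub> (q ^ i)" for \<beta> and i :: nat
  have u_cl: "u \<beta> i \<in> carrier F" if "\<beta> \<in> carrier F" for \<beta> i using that by (simp add: u_def)
  have hu: "h (u \<beta> i) = R.fr i (h \<beta>)" if "\<beta> \<in> carrier F" for \<beta> i
    using that by (simp add: u_def R.fr_def)
  have hsum: "h (\<Oplus>\<^bsub>F\<^esub>i\<in>{..<n}. c i \<otimes>\<^bsub>F\<^esub> u \<beta> i) = (\<Oplus>\<^bsub>L\<^esub>i\<in>{..<n}. h (c i) \<otimes>\<^bsub>L\<^esub> R.fr i (h \<beta>))"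
    if "\<And>i. i < n \<Longrightarrow> c i \<in> carrier F" "\<beta> \<in> carrier F" for c \<beta>
  proof -
    have "h (\<Oplus>\<^bsub>F\<^esub>i\<in>{..<n}. c i \<otimes>\<^bsub>F\<^esub> u \<beta> i) = (\<Oplus>\<^bsub>L\<^esub>i\<in>{..<n}. h (c i \<otimes>\<^bsub>F\<^esub> u \<beta> i))"
      using that u_cl by (subst H.hom_finsum) (auto simp: comp_def)
    also have "\<dots> = (\<Oplus>\<^bsub>L\<^esub>i\<in>{..<n}. h (c i) \<otimes>\<^bsub>L\<^esub> R.fr i (h \<beta>))"
      using that u_cl hu by (intro AC.finsum_cong') auto
    finally show ?thesis .
  qed
  have lift: "\<exists>c'. (\<forall>i. c' i \<in> K) \<and> c = (\<lambda>i. h (c' i))" if "\<forall>i. c i \<in> R.Fx 1" for c :: "nat \<Rightarrow> _"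
  proof -
    have "\<forall>i. \<exists>x. x \<in> K \<and> c i = h x" using that unfolding hK[symmetric] by blast
    then show ?thesis by metis
  qed

  have iff: "normal_over F K n \<beta> \<longleftrightarrow> R.normal (h \<beta>)" if \<beta>: "\<beta> \<in> carrier F" for \<beta>
  proof -
    let ?U = "map (u \<beta>) [0..<n]"
    have U: "set ?U \<subseteq> carrier F" using u_cl[OF \<beta>] by auto
    have NO: "normal_over F K n \<beta> \<longleftrightarrow> F.independent K ?U \<and> F.Span K ?U = carrier F"
      using \<beta> K(2) by (simp add: normal_over_def u_def[abs_def] Let_def)
    have hbF: "h \<beta> \<in> R.Fx n" using \<beta> hF by blast
    show ?thesis
    proof
      assume "normal_over F K n \<beta>"
      then have ind: "F.independent K ?U" using NO by blast
      show "R.normal (h \<beta>)"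
        unfolding R.normal_def nmk[symmetric]
      proof (intro allI impI, elim conjE)
        fix c i assume c: "\<forall>i. c i \<in> R.Fx 1" and s: "(\<Oplus>\<^bsub>L\<^esub>i\<in>{..<n}. c i \<otimes>\<^bsub>L\<^esub> R.fr i (h \<beta>)) = \<zero>\<^bsub>L\<^esub>"
          and i: "i < n"
        obtain c' where c': "\<And>i. c' i \<in> K" "c = (\<lambda>i. h (c' i))" using lift[OF c] by blast
        then have cF: "c' i \<in> carrier F" for i using Ksub by blast
        let ?s = "\<Oplus>\<^bsub>F\<^esub>i\<in>{..<n}. c' i \<otimes>\<^bsub>F\<^esub> u \<beta> i"
        have sc: "?s \<in> carrier F" using cF u_cl[OF \<beta>] by (intro F.finsum_closed) auto
        have hs: "h ?s = h \<zero>\<^bsub>F\<^esub>" using s cF \<beta> by (subst hsum) (auto simp: c'(2))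
        have "?s = \<zero>\<^bsub>F\<^esub>" by (rule inj_onD[OF h_inj hs sc]) simp
        then have "F.combine (map c' [0..<n]) ?U = \<zero>\<^bsub>F\<^esub>"
          using cF u_cl[OF \<beta>] by (subst F.combine_map_upt) auto
        then have "set (take (length ?U) (map c' [0..<n])) \<subseteq> {\<zero>\<^bsub>F\<^esub>}"
          using c'(1) by (intro F.independent_imp_trivial_combine[OF K(1) ind]) auto
        then have "c' i = \<zero>\<^bsub>F\<^esub>" using i by (auto simp: image_subset_iff)
        then show "c i = \<zero>\<^bsub>L\<^esub>" by (simp add: c'(2))
      qed
    next
      assume nrm: "R.normal (h \<beta>)"
      have "F.independent K ?U"
      proof (rule F.trivial_combine_imp_independent[OF K(1) U])
        fix Ks assume Ks: "set Ks \<subseteq> K" "F.combine Ks ?U = \<zero>\<^bsub>F\<^esub>"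
        have KsF: "set Ks \<subseteq> carrier F" using Ks Ksub by blast
        \<comment> \<open>\<open>combine\<close> accepts coefficient lists of any length, so the
          list is first cut or padded with zeros to length \<open>n\<close>.\<close>
        obtain Ks' where Ks': "set (take (length ?U) Ks) \<subseteq> set Ks'"
            "set Ks' \<subseteq> set (take (length ?U) Ks) \<union> {\<zero>\<^bsub>F\<^esub>}"
            "length Ks' = length ?U" "F.combine Ks' ?U = \<zero>\<^bsub>F\<^esub>"
          using F.combine_normalize[OF KsF U Ks(2)] by blast
        have z: "\<zero>\<^bsub>F\<^esub> \<in> K" using subringE(2)[OF subfieldE(1)[OF K(1)]] .
        define c where "c i = (if i < n then Ks' ! i else \<zero>\<^bsub>F\<^esub>)" for i
        have Ksub': "set Ks' \<subseteq> K" using Ks'(2) Ks(1) z set_take_subset[of "length ?U" Ks] by blast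
        then have cK: "c i \<in> K" for i using Ks'(3) z by (auto simp: c_def subset_iff)
        then have cF: "c i \<in> carrier F" for i using Ksub by blast
        have Kc: "Ks' = map c [0..<n]" using Ks'(3) by (intro nth_equalityI) (auto simp: c_def)
        have "(\<Oplus>\<^bsub>F\<^esub>i\<in>{..<n}. c i \<otimes>\<^bsub>F\<^esub> u \<beta> i) = \<zero>\<^bsub>F\<^esub>"
          using Ks'(4) cF u_cl[OF \<beta>] unfolding Kc by (subst (asm) F.combine_map_upt) auto
        then have "(\<Oplus>\<^bsub>L\<^esub>i\<in>{..<n}. h (c i) \<otimes>\<^bsub>L\<^esub> R.fr i (h \<beta>)) = \<zero>\<^bsub>L\<^esub>"
          using hsum[of c \<beta>] cF \<beta> by simp
        moreover have "\<forall>i. h (c i) \<in> R.Fx 1" using cK hK by blast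
        ultimately have hz: "\<forall>i<n. h (c i) = \<zero>\<^bsub>L\<^esub>"
          using nrm[unfolded R.normal_def nmk[symmetric], rule_format, of "\<lambda>i. h (c i)"] by blast
        have "c i = \<zero>\<^bsub>F\<^esub>" if "i < n" for i
        proof -
          have "h (c i) = h \<zero>\<^bsub>F\<^esub>" using hz that by simp
          then show ?thesis using inj_onD[OF h_inj _ cF] by auto
        qed
        then have "set Ks' \<subseteq> {\<zero>\<^bsub>F\<^esub>}" unfolding Kc by auto
        then show "set (take (length ?U) Ks) \<subseteq> {\<zero>\<^bsub>F\<^esub>}" using Ks'(1) by blast
      qed
      moreover have "carrier F \<subseteq> F.Span K ?U"
      proof
        fix y assume y: "y \<in> carrier F"
        then have "h y \<in> R.Fx (m * p ^ k)" using hF nmk by blast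
        then obtain c where c: "\<forall>i. c i \<in> R.Fx 1" "h y = (\<Oplus>\<^bsub>L\<^esub>i\<in>{..<n}. c i \<otimes>\<^bsub>L\<^esub> R.fr i (h \<beta>))"
          using R.normal_spans[OF cardF[unfolded nmk] cardK hbF[unfolded nmk] nrm] unfolding nmk[symmetric] by blast
        obtain c' where c': "\<And>i. c' i \<in> K" "c = (\<lambda>i. h (c' i))" using lift[OF c(1)] by blast
        then have cF: "c' i \<in> carrier F" for i using Ksub by blast
        let ?s = "\<Oplus>\<^bsub>F\<^esub>i\<in>{..<n}. c' i \<otimes>\<^bsub>F\<^esub> u \<beta> i"
        have sc: "?s \<in> carrier F" using cF u_cl[OF \<beta>] by (intro F.finsum_closed) auto
        have hs: "h y = h ?s" using c(2) cF \<beta> by (subst hsum) (auto simp: c'(2))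
        have "y = ?s" by (rule inj_onD[OF h_inj hs y sc])
        also have "\<dots> = F.combine (map c' [0..<n]) ?U"
          using cF u_cl[OF \<beta>] by (subst F.combine_map_upt) auto
        finally show "y \<in> F.Span K ?U"
          unfolding F.Span_eq_combine_set[OF K(1) U] using c'(1) by fastforce
      qed
      ultimately show "normal_over F K n \<beta>"
        using NO F.Span_in_carrier[OF Ksub U] by blast
    qed
  qed

  have "h ` {\<beta>. normal_over F K n \<beta>} = {x \<in> R.Fx n. R.normal x}"
  proof -
    have "{\<beta>. normal_over F K n \<beta>} = {\<beta> \<in> carrier F. R.normal (h \<beta>)}"
      using iff by (auto simp: normal_over_def)
    then show ?thesis unfolding hF[symmetric] by auto
  qed
  moreover have "inj_on h {\<beta>. normal_over F K n \<beta>}"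
    using h_inj by (rule inj_on_subset) (auto simp: normal_over_def)
  ultimately have cardN: "card {\<beta>. normal_over F K n \<beta>} = card {x \<in> R.Fx n. R.normal x}"
    using card_image by metis

  define D where "D j = m div gcd j m" for j
  obtain Rep where Rep: "finite Rep" "Rep \<subseteq> {..<m}"
    "\<And>j. j < m \<Longrightarrow> \<exists>i\<in>Rep. \<exists>t. [j = i * q ^ t] (mod m)"
    "\<And>d. d dvd m \<Longrightarrow> card {i \<in> Rep. D i = d} * ord d q = totient d"
    using orbit_representatives[OF mq m0] unfolding D_def by blast
  define kk where "kk i = ord (D i) q" for i
  have D_dvd: "D j dvd m" for j unfolding D_def by (simp add: div_dvd_iff_mult m0)
  have cop: "coprime d q" if "d dvd m" for d using that mq by (meson coprime_divisors dvd_refl)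
  have kk0: "kk i > 0" for i using cop[OF D_dvd] by (simp add: kk_def)
  have kk1: "[i * q ^ kk i = i] (mod m)" for i
    using mult_power_cong_iff[OF mq m0, of i "kk i" 0] by (simp add: kk_def D_def cong_def)
  have fin: "finite {d. d dvd m}" using m0 by simp
  have part: "Rep = (\<Union>d\<in>{d. d dvd m}. {i\<in>Rep. D i = d})" using D_dvd by auto
  have kk_sum: "(\<Sum>i\<in>Rep. kk i) = m"
  proof -
    have "(\<Sum>i\<in>Rep. kk i) = (\<Sum>d | d dvd m. \<Sum>i\<in>{i\<in>Rep. D i = d}. kk i)"
      by (subst part, intro sum.UNION_disjoint) (use fin Rep(1) in auto)
    also have "\<dots> = (\<Sum>d | d dvd m. card {i \<in> Rep. D i = d} * ord d q)"
      by (intro sum.cong) (auto simp: kk_def)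
    also have "\<dots> = (\<Sum>d | d dvd m. totient d)" using Rep(4) by (intro sum.cong) auto
    finally show ?thesis by (simp add: totient_divisor_sum)
  qed
  have "card {x \<in> R.Fx n. R.normal x} = q ^ (n - m) * (\<Prod>i\<in>Rep. q ^ kk i - 1)"
    using R.card_normal[OF cardF[unfolded nmk] cardK Rep(1-3) kk0 kk1 kk_sum] unfolding nmk[symmetric] by simp
  then have "normal_density F K n = real (q ^ (n - m)) * (\<Prod>i\<in>Rep. real (q ^ kk i - 1)) / real (q ^ n)"
    by (simp add: normal_density_def cardN K(2))
  also have "real (q ^ n) = real (q ^ (n - m)) * (\<Prod>i\<in>Rep. real (q ^ kk i))"
  proof -
    have "p ^ k > 0" using p1 by simp
    then have "m \<le> n" unfolding nmk by (cases "p ^ k") simp_all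
    then have "q ^ n = q ^ (n - m) * q ^ m" by (simp add: power_add[symmetric])
    also have "q ^ m = (\<Prod>i\<in>Rep. q ^ kk i)" by (simp add: power_sum[symmetric] kk_sum)
    finally show ?thesis by (simp del: of_nat_power)
  qed
  also have "real (q ^ (n - m)) * (\<Prod>i\<in>Rep. real (q ^ kk i - 1)) / (real (q ^ (n - m)) * (\<Prod>i\<in>Rep. real (q ^ kk i)))
     = (\<Prod>i\<in>Rep. real (q ^ kk i - 1) / real (q ^ kk i))"
    using q1 by (simp add: prod_dividef)
  also have "\<dots> = (\<Prod>i\<in>Rep. 1 - 1 / real q ^ kk i)"
    using q1 by (intro prod.cong) (auto simp: of_nat_diff field_simps)
  also have "\<dots> = (\<Prod>d | d dvd m. \<Prod>i\<in>{i\<in>Rep. D i = d}. 1 - 1 / real q ^ kk i)"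
    by (subst part, intro prod.UNION_disjoint) (use fin Rep(1) in auto)
  also have "\<dots> = (\<Prod>d | d dvd m. (1 - 1 / real q ^ ord d q) ^ card {i\<in>Rep. D i = d})"
    by (intro prod.cong) (auto simp: kk_def)
  also have "\<dots> = (\<Prod>d | d dvd m. (1 - 1 / real q ^ ord d q) ^ (totient d div ord d q))"
  proof (intro prod.cong refl)
    fix d assume "d \<in> {d. d dvd m}"
    then have "card {i \<in> Rep. D i = d} * ord d q = totient d" "ord d q > 0" using Rep(4) cop by auto
    then have "card {i \<in> Rep. D i = d} = totient d div ord d q"
      by (metis nonzero_mult_div_cancel_right less_not_refl)
    then show "(1 - 1 / real q ^ ord d q) ^ card {i\<in>Rep. D i = d} = (1 - 1 / real q ^ ord d q) ^ (totient d div ord d q)" by simp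
  qed
  \<comment> \<open>The only prime dividing \<open>q\<close> is \<open>p\<close>, and
    \<open>m\<close> is \<open>n\<close> without its factors \<open>p\<close>.\<close>
  also have "{d. d dvd m} = {d. d dvd n \<and> coprime d q}"
  proof safe
    fix d assume "d dvd m" then show "d dvd n" "coprime d q" using nmk cop by auto
  next
    fix d assume "d dvd n" "coprime d q"
    moreover from this have "coprime d (p ^ k)" using pr by simp
    ultimately show "d dvd m" using nmk by (simp add: coprime_dvd_mult_left_iff)
  qed
  finally show ?thesis .
qed

section \<open>Divisor sums of the totient ratio\<close>

definition totient_ratio_sum :: "nat \<Rightarrow> real" where
  "totient_ratio_sum m = (\<Sum>d | d dvd m. real (totient d) / real d)"

lemma totient_ratio_sum_nonneg: "totient_ratio_sum m \<ge> 0"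
  unfolding totient_ratio_sum_def by (intro sum_nonneg) auto

lemma totient_ratio_sum_1 [simp]: "totient_ratio_sum (Suc 0) = 1"
  by (simp add: totient_ratio_sum_def)

text \<open>Raising the exponent of \<open>p\<close> by one adds exactly the divisors
  \<open>p ^ Suc a * e\<close> with \<open>e dvd m\<close>, and each has the ratio of
  \<open>e\<close> times 1 - 1/p.\<close>

lemma totient_ratio_sum_prime_power_mult:
  assumes p: "prime p" and m: "m > 0" "\<not> p dvd m"
  shows "totient_ratio_sum (p ^ a * m) = (1 + real a * (1 - 1 / real p)) * totient_ratio_sum m"
proof (induction a)
  case (Suc a)
  have p0: "p > 0" using p by (rule prime_gt_0_nat)
  let ?h = "\<lambda>d. real (totient d) / real d"
  let ?E = "(\<lambda>e. p ^ Suc a * e) ` {e. e dvd m}"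
  have cop: "coprime (p ^ Suc a) e" if "e dvd m" for e
    using that m(2) p by (auto intro!: prime_imp_coprime dest: dvd_trans)
  have split: "{d. d dvd p ^ Suc a * m} = {d. d dvd p ^ a * m} \<union> ?E"
  proof (intro equalityI subsetI)
    fix d assume "d \<in> {d. d dvd p ^ Suc a * m}"
    then obtain x y where xy: "d = x * y" "x dvd p ^ Suc a" "y dvd m"
      using dvd_productE[of d "p ^ Suc a" m] by blast
    then obtain i where i: "i \<le> Suc a" "x = p ^ i" using divides_primepow_nat[OF p] by blast
    show "d \<in> {d. d dvd p ^ a * m} \<union> ?E"
    proof (cases "i = Suc a")
      case False
      then have "x dvd p ^ a" using i by (auto intro: le_imp_power_dvd)
      then show ?thesis using xy by (auto intro: mult_dvd_mono)
    qed (use xy i in auto)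
  next
    fix d assume "d \<in> {d. d dvd p ^ a * m} \<union> ?E"
    then show "d \<in> {d. d dvd p ^ Suc a * m}" by (auto intro: dvd_mult mult_dvd_mono simp: mult.assoc)
  qed
  have disj: "{d. d dvd p ^ a * m} \<inter> ?E = {}"
  proof -
    have False if "p ^ Suc a * e dvd p ^ a * m" for e
    proof -
      have "p ^ a * (p * e) dvd p ^ a * m" using that by (simp add: mult_ac)
      then have "p * e dvd m" using p0 by simp
      then show False using m(2) by (auto dest: dvd_mult_left)
    qed
    then show ?thesis by blast
  qed
  have "totient_ratio_sum (p ^ Suc a * m) = totient_ratio_sum (p ^ a * m) + sum ?h ?E"
    unfolding totient_ratio_sum_def split using disj m p0 by (intro sum.union_disjoint) auto
  also have "sum ?h ?E = (\<Sum>e | e dvd m. ?h (p ^ Suc a * e))"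
    using p0 by (subst sum.reindex) (auto simp: inj_on_def)
  also have "\<dots> = (\<Sum>e | e dvd m. (1 - 1 / real p) * ?h e)"
  proof (intro sum.cong refl)
    fix e assume e: "e \<in> {e. e dvd m}"
    then have e0: "e > 0" using m by (auto intro: Nat.gr0I)
    from e have "totient (p ^ Suc a * e) = p ^ a * (p - 1) * totient e"
      using totient_mult_coprime[OF cop, of e] totient_prime_power_Suc[OF p, of a] by simp
    moreover have "real (p - 1) = real p - 1" using p0 by (simp add: of_nat_diff)
    ultimately have "?h (p ^ Suc a * e) = real p ^ a * ((real p - 1) * real (totient e)) / (real p ^ a * (real p * real e))"
      by (simp add: mult_ac)
    also have "\<dots> = (1 - 1 / real p) * ?h e" using p0 e0 by (simp add: field_simps)
    finally show "?h (p ^ Suc a * e) = (1 - 1 / real p) * ?h e" .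
  qed
  also have "\<dots> = (1 - 1 / real p) * totient_ratio_sum m"
    by (simp add: totient_ratio_sum_def sum_distrib_left)
  finally have e: "totient_ratio_sum (p ^ Suc a * m) =
      totient_ratio_sum (p ^ a * m) + (1 - 1 / real p) * totient_ratio_sum m" .
  define y where "y = 1 / real p"
  show ?case unfolding e Suc y_def[symmetric] by (simp add: algebra_simps)
qed simp

text \<open>For primes \<open>p \<ge> 5\<close> the factor 1 + a (1 - 1/p) is replaced by 1 + a.
  Equality holds at \<open>a = 1\<close>, and 4/5 is below the required 8/9.\<close>

lemma power_growth_5: "a \<ge> 1 \<Longrightarrow> (1 + real a) ^ 2 \<le> 4 / 5 * 5 ^ a"
proof (induction a rule: nat_induct_at_least)
  case (Suc a)
  have "(1 + real (Suc a)) ^ 2 \<le> 5 * (1 + real a) ^ 2"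
    by (simp add: power2_eq_square algebra_simps)
  then show ?case using Suc by simp
qed simp

text \<open>At \<open>a = 1\<close> this fails, since 25/9 exceeds 24/9; hence \<open>3\<close> is
  an exception in \<open>totient_ratio_sum_odd\<close>.\<close>

lemma power_growth_3: "a \<ge> 2 \<Longrightarrow> (1 + real a * (2 / 3)) ^ 2 \<le> 8 / 9 * 3 ^ a"
proof (induction a rule: nat_induct_at_least)
  case (Suc a)
  have "3 * (1 + real a * (2 / 3)) ^ 2 - (1 + real (Suc a) * (2 / 3)) ^ 2 = 2 / 9 + 16 / 9 * real a + 8 / 9 * real a ^ 2"
    by (simp add: power2_eq_square field_simps)
  moreover have "0 \<le> 2 / 9 + 16 / 9 * real a + 8 / 9 * real a ^ 2" by simp
  ultimately have "(1 + real (Suc a) * (2 / 3)) ^ 2 \<le> 3 * (1 + real a * (2 / 3)) ^ 2" by linarith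
  then show ?case using Suc by simp
qed (simp add: power2_eq_square)

text \<open>Equality holds at \<open>a = 2\<close>. At \<open>a = 1\<close> it fails: 9/4 against 2,
  which is the loss of 9/8.\<close>

lemma power_growth_2: "a \<ge> 2 \<Longrightarrow> (1 + real a / 2) ^ 2 \<le> 2 ^ a"
proof (induction a rule: nat_induct_at_least)
  case (Suc a)
  have "real a * real a \<ge> 2 * 2" using Suc.hyps by (intro mult_mono) auto
  then have "(1 + real (Suc a) / 2) ^ 2 \<le> 2 * (1 + real a / 2) ^ 2"
    using Suc.hyps by (simp add: power2_eq_square algebra_simps)
  then show ?case using Suc by simp
qed (simp add: power2_eq_square)

lemma prime_power_factor:
  fixes m :: nat
  assumes "m > 0" "prime p" "p dvd m"
  obtains a m' where "m = p ^ a * m'" "a \<ge> 1" "m' > 0" "\<not> p dvd m'" "m' < m"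
proof -
  obtain m' where m': "m = p ^ multiplicity p m * m'" "\<not> p dvd m'"
    using multiplicity_decompose'[of m p] assms(1) prime_gt_1_nat[OF assms(2)] by auto
  have a: "multiplicity p m \<ge> 1"
    using assms by (metis One_nat_def Suc_leI not_dvd_imp_multiplicity_0 multiplicity_gt_zero_iff 
       neq0_conv prime_imp_prime_elem not_prime_unit)
  have m'0: "m' > 0" using m'(1) assms(1) by (cases m') auto
  have "p ^ multiplicity p m > 1" using a assms(2) by (intro one_less_power prime_gt_1_nat) simp_all
  then have "1 * m' < p ^ multiplicity p m * m'" using m'0 by (intro mult_strict_right_mono) auto
  then have "m' < m" using m'(1) by simp
  then show ?thesis using that m' a m'0 by blast
qed

text \<open>The improvement to \<open>8/9\<close> absorbs the factor \<open>9/8\<close> that a single prime factor \<open>2\<close> costs.\<close>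
lemma totient_ratio_sum_odd:
  fixes m :: nat
  assumes "odd m"
  shows "totient_ratio_sum m ^ 2 \<le> real m \<and> 
    (m \<noteq> 1 \<and> m \<noteq> 3 \<longrightarrow> totient_ratio_sum m ^ 2 \<le> 8 / 9 * real m)"
  using assms
proof (induction m rule: less_induct)
  case (less m)
  have m0: "m > 0" using less.prems by (auto intro: Nat.gr0I)
  show ?case
  \<comment> \<open>One prime from 5 on already gains the factor 4/5, so the weak bound suffices for
    the cofactor. Otherwise the odd number \<open>m\<close> is a power of 3.\<close>
  proof (cases "\<exists>p. prime p \<and> p dvd m \<and> p \<ge> 5")
    case True
    then obtain p where p: "prime p" "p dvd m" "p \<ge> 5" by blast
    obtain a m' where am: "m = p ^ a * m'" "a \<ge> 1" "m' > 0" "\<not> p dvd m'" "m' < m"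
      using prime_power_factor[OF m0 p(1,2)] by blast
    have IH: "totient_ratio_sum m' ^ 2 \<le> real m'" using less am by auto
    have "(1 + real a * (1 - 1 / real p)) \<le> 1 + real a" using p by (simp add: mult_left_le)
    then have "(1 + real a * (1 - 1 / real p)) ^ 2 \<le> (1 + real a) ^ 2"
      using p by (intro power_mono) auto
    also have "\<dots> \<le> 4 / 5 * 5 ^ a" using power_growth_5[OF am(2)] .
    also have "\<dots> \<le> 4 / 5 * real p ^ a" using p by (intro mult_left_mono power_mono) auto
    finally have "(1 + real a * (1 - 1 / real p)) ^ 2 \<le> 4 / 5 * real p ^ a" .
    then have "totient_ratio_sum m ^ 2 \<le> (4 / 5 * real p ^ a) * real m'"
      unfolding am(1) totient_ratio_sum_prime_power_mult[OF p(1) am(3,4)] power_mult_distrib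
      using IH by (intro mult_mono) auto
    also have "\<dots> = 4 / 5 * real m" using am(1) by simp
    finally show ?thesis by auto
  next
    case False
    have only3: "p = 3" if "prime p" "p dvd m" for p
    proof -
      have "p < 5" using False that by auto
      moreover have "p \<noteq> 2" "p \<noteq> 4" using that less.prems by (auto elim: dvd_trans[rotated])
      moreover have "p > 1" using that(1) by (rule prime_gt_1_nat)
      ultimately show "p = 3" by linarith
    qed
    show ?thesis
    proof (cases "m = 1")
      case False
      have p3: "prime (3::nat)" by simp
      have "3 dvd m" using prime_factor_nat[OF False] only3 by blast
      then obtain a m' where am: "m = 3 ^ a * m'" "a \<ge> 1" "m' > 0" "\<not> 3 dvd m'" "m' < m"
        using prime_power_factor[OF m0 p3] by blast
      have "m' = 1"
      proof (rule ccontr)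
        assume "m' \<noteq> 1"
        then obtain p where "prime p" "p dvd m'" using prime_factor_nat by blast
        then show False using only3[of p] am by auto
      qed
      then have m: "m = 3 ^ a" using am by simp
      have S: "totient_ratio_sum m = 1 + real a * (2 / 3)"
        using totient_ratio_sum_prime_power_mult[OF p3, of 1 a] by (simp add: m)
      show ?thesis
      proof (cases "a = 1")
        case True
        have "totient_ratio_sum m ^ 2 = 25 / 9" unfolding S True by (simp add: power2_eq_square)
        then show ?thesis using True m by simp
      next
        case False
        then have "totient_ratio_sum m ^ 2 \<le> 8 / 9 * real m"
          using power_growth_3[of a] am(2) unfolding S by (simp add: m)
        then show ?thesis by auto
      qed
    qed simp
  qed
qed

text \<open>The summand 1 is there for \<open>m = 2\<close> and \<open>m = 6\<close>, where the
  squares 9/4 and 25/4 exceed \<open>m\<close>. For \<open>m = q ^ k - 1\<close> the right side is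
  exactly \<open>q ^ k\<close>.\<close>

theorem totient_ratio_sum_bound:
  assumes m0: "m > 0"
  shows "totient_ratio_sum m ^ 2 < real m + 1"
proof (cases "odd m")
  case True
  then show ?thesis using totient_ratio_sum_odd[of m] by simp
next
  case False
  have p2: "prime (2::nat)" by simp
  obtain a m' where am: "m = 2 ^ a * m'" "a \<ge> 1" "m' > 0" "\<not> 2 dvd m'" "m' < m"
    using prime_power_factor[OF m0 p2] False by blast
  have S: "totient_ratio_sum m = (1 + real a / 2) * totient_ratio_sum m'"
    unfolding am(1) by (subst totient_ratio_sum_prime_power_mult[OF p2 am(3,4)]) simp
  note odd = totient_ratio_sum_odd[OF am(4)]
  show ?thesis
  proof (cases "a = 1")
    case False
    have "totient_ratio_sum m ^ 2 \<le> 2 ^ a * real m'"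
      unfolding S power_mult_distrib using power_growth_2[of a] False am(2) odd
      by (intro mult_mono) auto
    then show ?thesis using am(1) by simp
  next
    case True
    then have S': "totient_ratio_sum m = 3 / 2 * totient_ratio_sum m'" and m: "m = 2 * m'"
      using S am(1) by simp_all
    have sq: "totient_ratio_sum m ^ 2 = 9 / 4 * totient_ratio_sum m' ^ 2"
      unfolding S' by (simp add: power2_eq_square)
    consider "m' = 1" | "m' = 3" | "m' \<noteq> 1" "m' \<noteq> 3" by blast
    then show ?thesis
    proof cases
      case 1
      then show ?thesis using sq m by simp
    next
      case 2
      have "totient_ratio_sum (3 ^ 1 * 1) = 5 / 3"
        by (subst totient_ratio_sum_prime_power_mult) auto
      then have S3: "totient_ratio_sum m' = 5 / 3" using 2 by simp
      have "totient_ratio_sum m ^ 2 = 25 / 4" unfolding sq S3 by (simp add: power2_eq_square)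
      then show ?thesis using m 2 by simp
    next
      case 3
      then show ?thesis using sq m odd by simp
    qed
  qed
qed

section \<open>Mean values of products over divisors\<close>

text \<open>The deviation \<open>h\<close> of the partial sums from linear growth is itself
  periodic, hence bounded, and vanishes after division by \<open>N\<close>.\<close>

lemma periodic_mean:
  fixes f :: "nat \<Rightarrow> real"
  assumes P: "P > 0" and per: "\<And>n. f (n + P) = f n"
  shows "(\<lambda>N. (\<Sum>n=1..N. f n) / real N) \<longlonglongrightarrow> (\<Sum>n=1..P. f n) / real P"
proof -
  define M where "M = (\<Sum>n=1..P. f n) / real P"
  define h where "h N = (\<Sum>n=1..N. f n) - real N * M" for N
  have h_Suc: "h (Suc N) = h N + f (Suc N) - M" for N by (simp add: h_def algebra_simps)
  have h_per: "h (N + P) = h N" for N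
  proof (induction N)
    case 0
    then show ?case using P by (simp add: h_def M_def)
  next
    case (Suc N)
    then show ?case using h_Suc[of "N + P"] h_Suc[of N] per[of "Suc N"] by simp
  qed
  have h_per': "h (N + i * P) = h N" for N i
  proof (induction i)
    case (Suc i)
    then show ?case using h_per[of "N + i * P"] by (simp add: add_ac)
  qed simp
  define B where "B = Max ((\<lambda>N. \<bar>h N\<bar>) ` {..<P})"
  have hB: "\<bar>h N\<bar> \<le> B" for N
  proof -
    have "h N = h (N mod P)" using h_per'[of "N mod P" "N div P"] by (simp add: mult.commute)
    also have "\<bar>\<dots>\<bar> \<le> B" unfolding B_def using P by (intro Max_ge) auto
    finally show ?thesis .
  qed
  have "(\<lambda>N. h N / real N) \<longlonglongrightarrow> 0"
  proof (rule tendsto_0_le)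
    show "(\<lambda>N. B / real N) \<longlonglongrightarrow> 0" by (rule lim_const_over_n)
    have "\<bar>h N\<bar> \<le> \<bar>B\<bar>" for N using hB[of N] by arith
    then show "\<forall>\<^sub>F N in sequentially. norm (h N / real N) \<le> norm (B / real N) * 1"
      by (intro always_eventually) (simp add: abs_divide divide_right_mono)
  qed
  then have "(\<lambda>N. M + h N / real N) \<longlonglongrightarrow> M + 0" by (intro tendsto_intros)
  moreover have "\<forall>\<^sub>F N in sequentially. M + h N / real N = (\<Sum>n=1..N. f n) / real N"
    using eventually_gt_at_top[of 0] by eventually_elim (simp add: h_def field_simps)
  ultimately show ?thesis unfolding M_def[symmetric] by (simp add: Lim_transform_eventually)
qed

lemma convergent_of_approximations:
  fixes A :: "nat \<Rightarrow> real"
  assumes "\<And>e. e > 0 \<Longrightarrow> \<exists>B. convergent B \<and> (\<forall>N. \<bar>A N - B N\<bar> \<le> e)"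
  shows "convergent A"
proof -
  have "Cauchy A"
  proof (rule CauchyI)
    fix e :: real assume e: "e > 0"
    then obtain B where B: "convergent B" "\<And>N. \<bar>A N - B N\<bar> \<le> e / 4"
      using assms[of "e / 4"] by auto
    then have "Cauchy B" by (simp add: Cauchy_convergent_iff)
    then obtain K where K: "\<And>m n. m \<ge> K \<Longrightarrow> n \<ge> K \<Longrightarrow> norm (B m - B n) < e / 4"
      using e by (meson CauchyD divide_pos_pos zero_less_numeral)
    have "norm (A m - A n) < e" if "m \<ge> K" "n \<ge> K" for m n
      using K[OF that] B(2)[of m] B(2)[of n] e unfolding real_norm_def by arith
    then show "\<exists>K. \<forall>m\<ge>K. \<forall>n\<ge>K. norm (A m - A n) < e" by blast
  qed
  then show ?thesis by (simp add: Cauchy_convergent_iff)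
qed

text \<open>The Weierstrass product inequality.\<close>

lemma prod_ge_one_minus_sum:
  fixes a :: "'b \<Rightarrow> real"
  assumes "finite S" "\<And>i. i \<in> S \<Longrightarrow> 0 \<le> a i" "\<And>i. i \<in> S \<Longrightarrow> a i \<le> 1"
  shows "1 - (\<Sum>i\<in>S. 1 - a i) \<le> (\<Prod>i\<in>S. a i)"
  using assms
proof (induction S)
  case (insert x S)
  have le: "(\<Prod>i\<in>S. a i) \<le> 1" "(\<Prod>i\<in>S. a i) \<ge> 0" using insert by (auto intro: prod_le_1 prod_nonneg)
  have "(1 - a x) * (\<Prod>i\<in>S. a i) \<le> (1 - a x) * 1" using le insert by (intro mult_left_mono) auto
  then have "(\<Prod>i\<in>S. a i) - (1 - a x) \<le> a x * (\<Prod>i\<in>S. a i)" by (simp add: algebra_simps)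
  moreover have "1 - (\<Sum>i\<in>S. 1 - a i) \<le> (\<Prod>i\<in>S. a i)" using insert by auto
  ultimately show ?case using insert by simp
qed simp

text \<open>After swapping the sums, each \<open>d\<close> is counted once for each of its at most
  N/d multiples up to \<open>N\<close>.\<close>

lemma divisor_double_sum_le:
  fixes b :: "nat \<Rightarrow> real"
  assumes b: "\<And>d. b d \<ge> 0"
  shows "(\<Sum>n=1..N. \<Sum>d | d dvd n \<and> P d. b d) \<le> real N * (\<Sum>d | d \<in> {1..N} \<and> P d. b d / real d)"
proof -
  have "(\<Sum>n=1..N. \<Sum>d | d dvd n \<and> P d. b d) = (\<Sum>n=1..N. \<Sum>d | d \<in> {1..N} \<and> P d. if d dvd n then b d else 0)"
  proof (rule sum.cong[OF refl])
    fix n assume n: "n \<in> {1..N}"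
    have "(\<Sum>d | d \<in> {1..N} \<and> P d. if d dvd n then b d else 0) = (\<Sum>d\<in>{d. d \<in> {1..N} \<and> P d} \<inter> {d. d dvd n}. b d)"
      by (subst sum.inter_restrict) auto
    also have "{d. d \<in> {1..N} \<and> P d} \<inter> {d. d dvd n} = {d. d dvd n \<and> P d}"
      using n by (auto dest: dvd_imp_le intro: Nat.gr0I)
    finally show "(\<Sum>d | d dvd n \<and> P d. b d) = (\<Sum>d | d \<in> {1..N} \<and> P d. if d dvd n then b d else 0)" by simp
  qed
  also have "\<dots> = (\<Sum>d | d \<in> {1..N} \<and> P d. \<Sum>n=1..N. if d dvd n then b d else 0)"
    by (rule sum.swap)
  also have "\<dots> \<le> (\<Sum>d | d \<in> {1..N} \<and> P d. real N * (b d / real d))"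
  proof (rule sum_mono)
    fix d assume "d \<in> {d. d \<in> {1..N} \<and> P d}"
    then have d: "d \<ge> 1" by auto
    have "{n \<in> {1..N}. d dvd n} \<subseteq> (\<lambda>i. d * i) ` {1..N div d}"
    proof
      fix n assume n: "n \<in> {n \<in> {1..N}. d dvd n}"
      then obtain i where i: "n = d * i" by auto
      then have "i \<ge> 1" "d * i \<le> N" using n by (auto simp: Suc_le_eq)
      then have "i \<le> N div d" using d by (simp add: less_eq_div_iff_mult_less_eq mult.commute)
      then show "n \<in> (\<lambda>i. d * i) ` {1..N div d}" using i \<open>i \<ge> 1\<close> by auto
    qed
    then have "card {n \<in> {1..N}. d dvd n} \<le> card ((\<lambda>i. d * i) ` {1..N div d})" by (rule card_mono[rotated]) simp
    also have "\<dots> \<le> N div d" by (rule order_trans[OF card_image_le]) auto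
    finally have "real (card {n \<in> {1..N}. d dvd n}) \<le> real (N div d)" by simp
    also have "real (N div d) \<le> real N / real d"
    proof -
      have "real (N div d * d) \<le> real N" by (intro of_nat_mono div_times_less_eq_dividend)
      then show ?thesis using d by (simp add: le_divide_eq)
    qed
    finally have c: "real (card {n \<in> {1..N}. d dvd n}) \<le> real N / real d" .
    have "(\<Sum>n=1..N. if d dvd n then b d else 0) = (\<Sum>n\<in>{n \<in> {1..N}. d dvd n}. b d)"
      by (rule sum.inter_filter[symmetric]) simp
    also have "\<dots> = real (card {n \<in> {1..N}. d dvd n}) * b d" by simp
    also have "\<dots> \<le> real N / real d * b d" using c b by (rule mult_right_mono)
    finally show "(\<Sum>n=1..N. if d dvd n then b d else 0) \<le> real N * (b d / real d)" by simp
  qed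
  also have "\<dots> = real N * (\<Sum>d | d \<in> {1..N} \<and> P d. b d / real d)" by (simp add: sum_distrib_left)
  finally show ?thesis .
qed

section \<open>Mean values for factors between 0 and 1\<close>

context
  fixes a :: "nat \<Rightarrow> real"
  assumes a_nonneg: "\<And>d. 0 \<le> a d" and a_le_1: "\<And>d. a d \<le> 1"
begin

text \<open>The factors outside \<open>Q\<close> multiply to at most 1 and, by
  \<open>prod_ge_one_minus_sum\<close>, to at least 1 minus their total deficit. It serves with
  \<open>d \<le> D\<close> for truncation and with \<open>d = 1\<close> for the bounds.\<close>

lemma divisor_prod_split:
  assumes n: "n > 0"
  shows "(\<Prod>d | d dvd n. a d) \<le> (\<Prod>d | d dvd n \<and> Q d. a d)"
    and "(\<Prod>d | d dvd n \<and> Q d. a d) * (1 - (\<Sum>d | d dvd n \<and> \<not> Q d. 1 - a d)) \<le> (\<Prod>d | d dvd n. a d)"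
proof -
  let ?A = "{d. d dvd n \<and> Q d}" and ?B = "{d. d dvd n \<and> \<not> Q d}"
  have fin: "finite ?A" "finite ?B" using n by auto
  have U: "{d. d dvd n} = ?A \<union> ?B" by auto
  have eq: "(\<Prod>d | d dvd n. a d) = (\<Prod>d\<in>?A. a d) * (\<Prod>d\<in>?B. a d)"
    by (subst U, rule prod.union_disjoint) (use fin in auto)
  have A: "(\<Prod>d\<in>?A. a d) \<ge> 0" by (intro prod_nonneg) (simp add: a_nonneg)
  have B: "(\<Prod>d\<in>?B. a d) \<le> 1" by (intro prod_le_1) (simp add: a_nonneg a_le_1)
  show "(\<Prod>d | d dvd n. a d) \<le> (\<Prod>d\<in>?A. a d)" unfolding eq using A B by (rule mult_left_le[rotated])
  show "(\<Prod>d\<in>?A. a d) * (1 - (\<Sum>d\<in>?B. 1 - a d)) \<le> (\<Prod>d | d dvd n. a d)"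
    unfolding eq using A prod_ge_one_minus_sum[OF fin(2), of a] a_nonneg a_le_1
    by (intro mult_left_mono) auto
qed

text \<open>The product over divisors up to \<open>D\<close> has period D! and so a mean; the
  average error of this truncation is at most a tail of the summable series, uniformly in
  \<open>N\<close>.\<close>

lemma mean_of_divisor_prod_convergent:
  assumes sm: "summable (\<lambda>d. (1 - a d) / real d)"
  shows "convergent (\<lambda>N. (\<Sum>n=1..N. \<Prod>d | d dvd n. a d) / real N)"
proof (rule convergent_of_approximations)
  fix e :: real assume e: "e > 0"
  obtain D where D: "\<And>m n. m \<ge> D \<Longrightarrow> norm (\<Sum>d\<in>{m..<n}. (1 - a d) / real d) < e"
    using sm e unfolding summable_Cauchy by blast
  define g where "g n = (\<Prod>d | d dvd n. a d)" for n
  \<comment> \<open>The condition \<open>1 \<le> d\<close> matters for periodicity at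
    \<open>n = 0\<close>: zero divides 0 but not D!.\<close>
  define gD where "gD n = (\<Prod>d | d dvd n \<and> (1 \<le> d \<and> d \<le> D). a d)" for n
  have diff: "0 \<le> gD n - g n" "gD n - g n \<le> (\<Sum>d | d dvd n \<and> d > D. 1 - a d)" if "n > 0" for n
  proof -
    have B: "{d. d dvd n \<and> \<not> (1 \<le> d \<and> d \<le> D)} = {d. d dvd n \<and> d > D}"
      using that by (auto simp: not_le intro: Nat.gr0I)
    let ?s = "\<Sum>d | d dvd n \<and> d > D. 1 - a d"
    have s0: "?s \<ge> 0" using a_le_1 by (intro sum_nonneg) auto
    have "gD n \<le> 1" unfolding gD_def by (intro prod_le_1) (simp add: a_nonneg a_le_1)
    then have "gD n * ?s \<le> ?s" using s0 by (intro mult_left_le_one_le) (auto simp: gD_def intro!: prod_nonneg a_nonneg)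
    then show "0 \<le> gD n - g n" "gD n - g n \<le> ?s"
      using divisor_prod_split[OF that, of "\<lambda>d. 1 \<le> d \<and> d \<le> D"] unfolding B gD_def[symmetric] g_def[symmetric]
      by (auto simp: algebra_simps)
  qed
  have "gD (n + fact D) = gD n" for n
  proof -
    have "{d. d dvd n + fact D \<and> (1 \<le> d \<and> d \<le> D)} = {d. d dvd n \<and> (1 \<le> d \<and> d \<le> D)}"
      by (auto simp: dvd_fact dvd_add_left_iff)
    then show ?thesis by (simp add: gD_def)
  qed
  then have "convergent (\<lambda>N. (\<Sum>n=1..N. gD n) / real N)"
    using periodic_mean[of "fact D" gD] by (auto simp: convergent_def)
  moreover have "\<bar>(\<Sum>n=1..N. g n) / real N - (\<Sum>n=1..N. gD n) / real N\<bar> \<le> e" for N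
  proof (cases "N = 0")
    case False
    have "(\<Sum>n=1..N. gD n - g n) \<le> (\<Sum>n=1..N. \<Sum>d | d dvd n \<and> d > D. 1 - a d)"
      using diff by (intro sum_mono) auto
    also have "\<dots> \<le> real N * (\<Sum>d | d \<in> {1..N} \<and> d > D. (1 - a d) / real d)"
      using a_le_1 by (intro divisor_double_sum_le) simp
    also have "(\<Sum>d | d \<in> {1..N} \<and> d > D. (1 - a d) / real d) \<le> (\<Sum>d\<in>{D..<Suc N}. (1 - a d) / real d)"
      using a_le_1 by (intro sum_mono2) auto
    also have "\<dots> \<le> e" using D[of D "Suc N"] by simp
    finally have le: "(\<Sum>n=1..N. gD n - g n) \<le> real N * e" using False by (simp add: mult_left_mono)
    have ge: "(\<Sum>n=1..N. gD n - g n) \<ge> 0" using diff by (intro sum_nonneg) auto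
    have "\<bar>(\<Sum>n=1..N. g n) / real N - (\<Sum>n=1..N. gD n) / real N\<bar> = (\<Sum>n=1..N. gD n - g n) / real N"
      using ge by (simp add: sum_subtractf diff_divide_distrib[symmetric] abs_divide)
    also have "\<dots> \<le> e" using le False by (simp add: divide_le_eq mult.commute)
    finally show ?thesis .
  qed (use e in simp)
  ultimately show "\<exists>B. convergent B \<and> (\<forall>N. \<bar>(\<Sum>n=1..N. \<Prod>d | d dvd n. a d) / real N - B N\<bar> \<le> e)"
    unfolding g_def by blast
qed

text \<open>The divisor 1 contributes \<open>a 1\<close> to every product, and on average the other
  divisors lower the remaining factor by at most \<open>T\<close>.\<close>

lemma mean_of_divisor_prod_bounds:
  assumes lim: "(\<lambda>N. (\<Sum>n=1..N. \<Prod>d | d dvd n. a d) / real N) \<longlonglongrightarrow> M"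
    and T: "\<And>N. (\<Sum>d=2..N. (1 - a d) / real d) \<le> T"
  shows "a 1 * (1 - T) \<le> M" and "M \<le> a 1"
proof -
  define g where "g n = (\<Prod>d | d dvd n. a d)" for n
  have A: "{d. d dvd n \<and> d = 1} = {1}" for n :: nat by auto
  have up: "g n \<le> a 1" and low: "a 1 * (1 - (\<Sum>d | d dvd n \<and> d \<noteq> 1. 1 - a d)) \<le> g n" if "n > 0" for n
    using divisor_prod_split[OF that, of "\<lambda>d. d = 1"] unfolding A g_def by simp_all
  have mean_up: "(\<Sum>n=1..N. g n) / real N \<le> a 1" if "N > 0" for N
  proof -
    have "(\<Sum>n=1..N. g n) \<le> (\<Sum>n=1..N. a 1)" using up by (intro sum_mono) auto
    then show ?thesis using that by (simp add: divide_le_eq mult.commute)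
  qed
  have mean_low: "a 1 * (1 - T) \<le> (\<Sum>n=1..N. g n) / real N" if "N > 0" for N
  proof -
    have "(\<Sum>n=1..N. \<Sum>d | d dvd n \<and> d \<noteq> 1. 1 - a d) \<le> real N * (\<Sum>d | d \<in> {1..N} \<and> d \<noteq> 1. (1 - a d) / real d)"
      using a_le_1 by (intro divisor_double_sum_le) simp
    also have "{d. d \<in> {1..N} \<and> d \<noteq> 1} = {2..N}" by auto
    also have "real N * (\<Sum>d\<in>{2..N}. (1 - a d) / real d) \<le> real N * T" using T by (intro mult_left_mono) auto
    finally have le: "(\<Sum>n=1..N. \<Sum>d | d dvd n \<and> d \<noteq> 1. 1 - a d) \<le> real N * T" .
    have "real N * (a 1 * (1 - T)) = a 1 * (real N - real N * T)" by (simp add: algebra_simps)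
    also have "\<dots> \<le> a 1 * (real N - (\<Sum>n=1..N. \<Sum>d | d dvd n \<and> d \<noteq> 1. 1 - a d))"
      using le a_nonneg by (intro mult_left_mono) auto
    also have "\<dots> = (\<Sum>n=1..N. a 1 * (1 - (\<Sum>d | d dvd n \<and> d \<noteq> 1. 1 - a d)))"
      by (simp add: sum_distrib_left[symmetric] sum_subtractf)
    also have "\<dots> \<le> (\<Sum>n=1..N. g n)" using low by (intro sum_mono) auto
    finally show ?thesis using that by (simp add: le_divide_eq mult.commute)
  qed
  show "M \<le> a 1"
    using lim[folded g_def] mean_up by (intro LIMSEQ_le_const2) (auto intro!: exI[of _ 1])
  show "a 1 * (1 - T) \<le> M"
    using lim[folded g_def] mean_low by (intro LIMSEQ_le_const) (auto intro!: exI[of _ 1])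
qed

end

lemma mean_real_of_nat:
  fixes f :: "nat \<Rightarrow> real"
  assumes "(\<lambda>N. (\<Sum>n=1..N. f n) / real N) \<longlonglongrightarrow> M"
  shows "((\<lambda>x :: real. 1 / x * (\<Sum>n = 1..nat \<lfloor>x\<rfloor>. f n)) \<longlongrightarrow> M) at_top"
proof -
  define S where "S N = (\<Sum>n=1..N. f n)" for N
  have fl: "filterlim (\<lambda>x::real. nat \<lfloor>x\<rfloor>) sequentially at_top"
    by (intro filterlim_compose[OF filterlim_nat_sequentially filterlim_floor_sequentially])
  have 1: "((\<lambda>x::real. S (nat \<lfloor>x\<rfloor>) / real (nat \<lfloor>x\<rfloor>)) \<longlongrightarrow> M) at_top"
    using filterlim_compose[OF assms fl] by (simp add: S_def)
  have 2: "((\<lambda>x::real. real (nat \<lfloor>x\<rfloor>) / x) \<longlongrightarrow> 1) at_top"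
  proof (rule tendsto_sandwich)
    show "\<forall>\<^sub>F x::real in at_top. 1 - 1 / x \<le> real (nat \<lfloor>x\<rfloor>) / x"
      using eventually_gt_at_top[of 0]
    proof eventually_elim
      case (elim x)
      have "x - 1 \<le> real (nat \<lfloor>x\<rfloor>)" using elim by linarith
      then have "(x - 1) / x \<le> real (nat \<lfloor>x\<rfloor>) / x" using elim by (intro divide_right_mono) auto
      then show ?case using elim by (simp add: diff_divide_distrib)
    qed
    show "\<forall>\<^sub>F x::real in at_top. real (nat \<lfloor>x\<rfloor>) / x \<le> 1"
      using eventually_gt_at_top[of 0] by eventually_elim (simp add: divide_le_eq)
    have "((\<lambda>x::real. 1 - 1 / x) \<longlongrightarrow> 1 - 0) at_top"
      by (intro tendsto_diff tendsto_const tendsto_divide_0[OF tendsto_const] filterlim_at_top_imp_at_infinity filterlim_ident)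
    then show "((\<lambda>x::real. 1 - 1 / x) \<longlongrightarrow> 1) at_top" by simp
  qed simp
  have "((\<lambda>x::real. S (nat \<lfloor>x\<rfloor>) / real (nat \<lfloor>x\<rfloor>) * (real (nat \<lfloor>x\<rfloor>) / x)) \<longlongrightarrow> M * 1) at_top"
    using 1 2 by (rule tendsto_mult)
  moreover have "\<forall>\<^sub>F x::real in at_top. S (nat \<lfloor>x\<rfloor>) / real (nat \<lfloor>x\<rfloor>) * (real (nat \<lfloor>x\<rfloor>) / x) = 1 / x * S (nat \<lfloor>x\<rfloor>)"
    using eventually_ge_at_top[of 1]
  proof eventually_elim
    case (elim x)
    then have "real (nat \<lfloor>x\<rfloor>) \<noteq> 0" by linarith
    moreover have *: "u / v * (v / x) = 1 / x * u" if "v \<noteq> 0" for u v :: real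
      using that by simp
    ultimately show ?case by (intro *)
  qed
  ultimately have "((\<lambda>x::real. 1 / x * S (nat \<lfloor>x\<rfloor>)) \<longlongrightarrow> M * 1) at_top"
    by (rule Lim_transform_eventually)
  then show ?thesis by (simp add: S_def)
qed

section \<open>Bounds for the mean\<close>

text \<open>The value 1 at \<open>d\<close> not coprime to \<open>q\<close> lets the products run
  over all divisors of \<open>n\<close>.\<close>

definition local_density :: "nat \<Rightarrow> nat \<Rightarrow> real" where
  "local_density q d = (if coprime d q then (1 - 1 / real q ^ ord d q) ^ (totient d div ord d q) else 1)"

lemma local_density_bounds:
  assumes "q > 1"
  shows "0 \<le> local_density q d" "local_density q d \<le> 1"
proof -
  have "1 \<le> real q ^ ord d q" using assms by (intro one_le_power) simp
  then have "0 \<le> 1 - 1 / real q ^ ord d q" "1 - 1 / real q ^ ord d q \<le> 1" by (auto simp: divide_le_eq)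
  then show "0 \<le> local_density q d" "local_density q d \<le> 1"
    unfolding local_density_def by (auto intro: zero_le_power power_le_one)
qed

text \<open>Bernoulli's inequality, with the number of orbits belonging to \<open>d\<close> as
  exponent.\<close>

lemma local_density_deficit:
  assumes q: "q > 1" and cop: "coprime d q"
  shows "(1 - local_density q d) / real d
    \<le> 1 / (real (ord d q) * real q ^ ord d q) * (real (totient d) / real d)"
proof -
  have o: "ord d q > 0" "ord d q dvd totient d"
    using cop by (auto intro: order_divides_totient)
  have "1 \<le> real q ^ ord d q" using q by (intro one_le_power) simp
  then have "1 / real q ^ ord d q \<le> 1" by (simp add: divide_le_eq)
  then have "1 + real (totient d div ord d q) * (- (1 / real q ^ ord d q))
      \<le> (1 + - (1 / real q ^ ord d q)) ^ (totient d div ord d q)"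
    by (intro Bernoulli_inequality) simp
  then have "1 - local_density q d \<le> real (totient d div ord d q) * (1 / real q ^ ord d q)"
    using cop by (simp add: local_density_def)
  also have "real (totient d div ord d q) = real (totient d) / real (ord d q)"
    using o by (simp add: real_of_nat_div)
  finally have "(1 - local_density q d) / real d
      \<le> real (totient d) / real (ord d q) * (1 / real q ^ ord d q) / real d"
    by (rule divide_right_mono) simp
  then show ?thesis by (simp add: mult_ac)
qed

lemma power_sum_bound:
  fixes s :: real
  assumes "0 \<le> s" "s \<le> 1 / 2"
  shows "(\<Sum>k=2..N. s ^ k / real k) \<le> s ^ 2"
proof -
  \<comment> \<open>Half of the last power is kept in reserve: since \<open>s \<le> 1 / 2\<close>,
    it pays for the next term and the next reserve. The base case is an equality.\<close>
  have "(\<Sum>k=2..Suc (Suc N). s ^ k / real k) + s ^ (Suc (Suc N)) / 2 \<le> s ^ 2" for N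
  proof (induction N)
    case (Suc N)
    let ?u = "s ^ Suc (Suc N)"
    have u: "?u \<ge> 0" using assms by (intro zero_le_power)
    have "s * ?u \<le> 1 / 2 * ?u" using assms u by (intro mult_right_mono) auto
    moreover have "s * ?u / real (Suc (Suc (Suc N))) \<le> s * ?u / 2"
      using assms u by (intro divide_left_mono) auto
    ultimately have "s ^ Suc (Suc (Suc N)) / real (Suc (Suc (Suc N))) + s ^ Suc (Suc (Suc N)) / 2 \<le> ?u / 2"
      by simp
    moreover have "(\<Sum>k=2..Suc (Suc (Suc N)). s ^ k / real k)
        = (\<Sum>k=2..Suc (Suc N). s ^ k / real k) + s ^ Suc (Suc (Suc N)) / real (Suc (Suc (Suc N)))"
      by simp
    ultimately show ?case using Suc by linarith
  qed (use assms in \<open>simp add: numeral_2_eq_2\<close>)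
  note * = this
  show ?thesis
  proof (cases "N \<ge> 2")
    case True
    then obtain N' where "N = Suc (Suc N')" by (metis add_2_eq_Suc le_Suc_ex)
    moreover have "s ^ Suc (Suc N') / 2 \<ge> 0" using assms by simp
    ultimately show ?thesis using *[of N'] by simp
  qed simp
qed

text \<open>An index \<open>d \<ge> 2\<close> with order \<open>k\<close> divides
  \<open>q ^ k - 1\<close>, so the ratios for one \<open>k\<close> add up to at most S(q^k - 1) - 1.
  The term \<open>k = 1\<close> is kept; for \<open>k \<ge> 2\<close> the square root bound on S
  gives a total of at most 1/q, which cancels the -1 saved at \<open>k = 1\<close>.\<close>

lemma deficit_sum_bound:
  assumes q: "q \<ge> 4"
  shows "(\<Sum>d=2..N. (1 - local_density q d) / real d) \<le> totient_ratio_sum (q - 1) / real q"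
proof -
  define w where "w d = real (totient d) / real d" for d
  define B where "B = {d \<in> {2..N}. coprime d q}"
  define s where "s = 1 / sqrt (real q)"
  have q1: "q > 1" using q by simp
  have w0: "w d \<ge> 0" for d by (simp add: w_def)
  \<comment> \<open>Here \<open>q \<ge> 4\<close> enters: it makes
    \<open>s \<le> 1 / 2\<close>.\<close>
  have "sqrt (real q) \<ge> sqrt 4" using q by (intro real_sqrt_le_mono) simp
  then have "sqrt (real q) \<ge> 2" by simp
  then have s: "0 \<le> s" "s \<le> 1 / 2" unfolding s_def by (auto simp: divide_le_eq)
  have s2: "s ^ 2 = 1 / real q" by (simp add: s_def power_divide)
  have "(\<Sum>d=2..N. (1 - local_density q d) / real d) = (\<Sum>d\<in>B. (1 - local_density q d) / real d)"
    unfolding B_def by (intro sum.mono_neutral_right) (auto simp: local_density_def)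
  also have "\<dots> \<le> (\<Sum>d\<in>B. 1 / (real (ord d q) * real q ^ ord d q) * w d)"
    unfolding w_def using local_density_deficit[OF q1] by (intro sum_mono) (simp add: B_def)
  also have "\<dots> = (\<Sum>k\<in>{1..N}. \<Sum>d\<in>{d\<in>B. ord d q = k}. 1 / (real (ord d q) * real q ^ ord d q) * w d)"
  proof (rule sum.group[symmetric])
    show "(\<lambda>d. ord d q) ` B \<subseteq> {1..N}"
    proof safe
      fix d assume d: "d \<in> B"
      then have o: "ord d q > 0" by (simp add: B_def)
      have "ord d q \<le> totient d"
        using d by (intro dvd_imp_le order_divides_totient) (auto simp: B_def)
      also have "\<dots> \<le> d" by (rule totient_le)
      finally show "ord d q \<in> {1..N}" using d o by (auto simp: B_def Suc_le_eq)
    qed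
  qed (auto simp: B_def)
  also have "\<dots> \<le> (\<Sum>k\<in>{1..N}. 1 / (real k * real q ^ k) * (totient_ratio_sum (q ^ k - 1) - 1))"
  proof (rule sum_mono)
    fix k assume k: "k \<in> {1..N}"
    then have qk: "q ^ k > 1" using q1 by (intro one_less_power) auto
    have "(\<Sum>d\<in>{d\<in>B. ord d q = k}. w d) \<le> (\<Sum>d\<in>{d. d dvd q ^ k - 1} - {1}. w d)"
    proof (rule sum_mono2)
      show "finite ({d. d dvd q ^ k - 1} - {1})" using qk by simp
      show "{d \<in> B. ord d q = k} \<subseteq> {d. d dvd q ^ k - 1} - {1}"
      proof safe
        fix d
        show "d dvd q ^ ord d q - 1" by (intro cong_to_1_nat conjunct1[OF ord_works])
      qed (auto simp: B_def)
    qed (simp add: w0)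
    also have "\<dots> = totient_ratio_sum (q ^ k - 1) - 1"
      using qk by (simp add: totient_ratio_sum_def w_def sum_diff1)
    finally have le: "(\<Sum>d\<in>{d\<in>B. ord d q = k}. w d) \<le> totient_ratio_sum (q ^ k - 1) - 1" .
    have "(\<Sum>d\<in>{d\<in>B. ord d q = k}. 1 / (real (ord d q) * real q ^ ord d q) * w d)
        = 1 / (real k * real q ^ k) * (\<Sum>d\<in>{d\<in>B. ord d q = k}. w d)"
      unfolding sum_distrib_left by (intro sum.cong) auto
    also have "\<dots> \<le> 1 / (real k * real q ^ k) * (totient_ratio_sum (q ^ k - 1) - 1)"
      using le by (intro mult_left_mono) auto
    finally show "(\<Sum>d\<in>{d\<in>B. ord d q = k}. 1 / (real (ord d q) * real q ^ ord d q) * w d)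
        \<le> 1 / (real k * real q ^ k) * (totient_ratio_sum (q ^ k - 1) - 1)" .
  qed
  also have "\<dots> \<le> (totient_ratio_sum (q - 1) - 1) / real q + (\<Sum>k=2..N. s ^ k / real k)"
  proof -
    have le: "1 / (real k * real q ^ k) * (totient_ratio_sum (q ^ k - 1) - 1) \<le> s ^ k / real k" if k: "k \<ge> 2" for k
    proof -
      have "q ^ k > 1" using q1 k by (intro one_less_power) auto
      then have "totient_ratio_sum (q ^ k - 1) ^ 2 < real (q ^ k)"
        using totient_ratio_sum_bound[of "q ^ k - 1"] by (simp add: of_nat_diff)
      then have "totient_ratio_sum (q ^ k - 1) < sqrt (real (q ^ k))" by (rule real_less_rsqrt)
      also have "\<dots> = sqrt (real q) ^ k" by (simp add: real_sqrt_power)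
      finally have "totient_ratio_sum (q ^ k - 1) - 1 \<le> sqrt (real q) ^ k" by simp
      then have "1 / (real k * real q ^ k) * (totient_ratio_sum (q ^ k - 1) - 1) \<le> 1 / (real k * real q ^ k) * sqrt (real q) ^ k"
        by (intro mult_left_mono) auto
      also have "\<dots> = s ^ k / real k"
      proof -
        have "real q ^ k = sqrt (real q) ^ k * sqrt (real q) ^ k"
          by (simp add: power_mult_distrib[symmetric])
        then show ?thesis using q by (simp add: s_def power_divide field_simps)
      qed
      finally show ?thesis .
    qed
    show ?thesis
    proof (cases "N \<ge> 1")
      case True
      then have "{1..N} = insert 1 {2..N}" by auto
      then show ?thesis using sum_mono[of "{2..N}", OF le] by simp
    next
      case False
      have "0 \<le> (totient_ratio_sum (q - 1) - 1) / real q"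
      proof -
        have "(\<Sum>d\<in>{1}. w d) \<le> (\<Sum>d | d dvd q - 1. w d)"
          using w0 q by (intro sum_mono2) auto
        then show ?thesis by (simp add: totient_ratio_sum_def w_def)
      qed
      then show ?thesis using False by simp
    qed
  qed
  also have "\<dots> \<le> (totient_ratio_sum (q - 1) - 1) / real q + 1 / real q"
    using power_sum_bound[OF s, of N] unfolding s2 by simp
  also have "\<dots> = totient_ratio_sum (q - 1) / real q" by (simp add: diff_divide_distrib)
  finally show ?thesis .
qed

text \<open>\<open>F\<close> and \<open>K\<close> may be any family of models of the fields: by
  \<open>normal_density_formula\<close> the density depends only on \<open>q\<close> and
  \<open>n\<close>.\<close>

theorem theorem4p8:
  fixes q :: nat
    and F :: "nat \<Rightarrow> ('a, 'm) ring_scheme"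
    and K :: "nat \<Rightarrow> 'a set"
  assumes "primepow q" and "q \<ge> 4"
    and "\<And>n. n \<ge> 1 \<Longrightarrow> field (F n)"
    and "\<And>n. n \<ge> 1 \<Longrightarrow> order (F n) = q ^ n"
    and "\<And>n. n \<ge> 1 \<Longrightarrow> subfield (K n) (F n)"
    and "\<And>n. n \<ge> 1 \<Longrightarrow> card (K n) = q"
  shows "\<exists>M :: real.
    ((\<lambda>x :: real. 1 / x * (\<Sum>n = 1..nat \<lfloor>x\<rfloor>. normal_density (F n) (K n) n)) \<longlongrightarrow> M) at_top \<and>
    1 - 1 / real q - 1 / sqrt (real q) < M \<and>
    M \<le> 1 - 1 / real q"
proof -
  have q1: "q > 1" using assms(2) by simp
  let ?a = "local_density q" and ?T = "totient_ratio_sum (q - 1) / real q"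
  note a = local_density_bounds[OF q1]
  have density: "normal_density (F n) (K n) n = (\<Prod>d | d dvd n. ?a d)" if "n \<ge> 1" for n
  proof -
    have "normal_density (F n) (K n) n = (\<Prod>d | d dvd n \<and> coprime d q. ?a d)"
      using normal_density_formula[OF assms(1) _ assms(3-6)] that by (simp add: local_density_def)
    also have "\<dots> = (\<Prod>d | d dvd n. ?a d)"
      using that by (intro prod.mono_neutral_left) (auto simp: local_density_def)
    finally show ?thesis .
  qed
  have "summable (\<lambda>d. (1 - ?a d) / real d)"
  proof (rule summableI_nonneg_bounded)
    fix N
    \<comment> \<open>The term at 0 is zero by the convention for division by zero, and the one at 1
      is not covered by \<open>deficit_sum_bound\<close>.\<close>
    have "(\<Sum>d<N. (1 - ?a d) / real d) \<le> (\<Sum>d\<in>insert 0 (insert 1 {2..N}). (1 - ?a d) / real d)"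
      using a(2) by (intro sum_mono2) (auto intro!: divide_nonneg_nonneg)
    also have "\<dots> \<le> (1 - ?a 1) + ?T" using deficit_sum_bound[OF assms(2), of N] by simp
    finally show "(\<Sum>d<N. (1 - ?a d) / real d) \<le> (1 - ?a 1) + ?T" .
  qed (use a in \<open>auto intro!: divide_nonneg_nonneg\<close>)
  then obtain M where M: "(\<lambda>N. (\<Sum>n=1..N. \<Prod>d | d dvd n. ?a d) / real N) \<longlonglongrightarrow> M"
    using mean_of_divisor_prod_convergent[of ?a, OF a] by (auto simp: convergent_def)
  have a1: "?a 1 = 1 - 1 / real q" by (simp add: local_density_def)
  have bounds: "(1 - 1 / real q) * (1 - ?T) \<le> M" "M \<le> 1 - 1 / real q"
    using mean_of_divisor_prod_bounds[of ?a, OF a M deficit_sum_bound[OF assms(2)]] unfolding a1 by auto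
  \<comment> \<open>The strict lower bound for \<open>M\<close> originates in this strict
    inequality.\<close>
  have "totient_ratio_sum (q - 1) ^ 2 < real q"
    using totient_ratio_sum_bound[of "q - 1"] assms(2) by (simp add: of_nat_diff)
  then have "totient_ratio_sum (q - 1) < sqrt (real q)" by (rule real_less_rsqrt)
  then have "?T < sqrt (real q) / real q" using q1 by (intro divide_strict_right_mono) auto
  also have "\<dots> = 1 / sqrt (real q)" using q1 by (simp add: field_simps)
  finally have T: "?T < 1 / sqrt (real q)" .
  have "0 \<le> 1 / real q * ?T" using totient_ratio_sum_nonneg by simp
  moreover have "(1 - y) * (1 - t) = 1 - y - t + y * t" for y t :: real by (simp add: algebra_simps)
  ultimately have "1 - 1 / real q - ?T \<le> (1 - 1 / real q) * (1 - ?T)" by simp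
  then have "1 - 1 / real q - 1 / sqrt (real q) < M" using T bounds(1) by linarith
  moreover have "((\<lambda>x :: real. 1 / x * (\<Sum>n = 1..nat \<lfloor>x\<rfloor>. normal_density (F n) (K n) n)) \<longlongrightarrow> M) at_top"
  proof (rule mean_real_of_nat)
    show "(\<lambda>N. (\<Sum>n=1..N. normal_density (F n) (K n) n) / real N) \<longlonglongrightarrow> M"
      using M density by simp
  qed
  ultimately show ?thesis using bounds(2) by blast
qed

end
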